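(* Let $m,n$ be positive integers, let $\mathbf p$ be a lattice point, and let $C_+,C_-,C_0$ be monotone curves from $(0,0)$ to $(m,n)$ such that $C_+$ passes strictly above $\mathbf p$, $C_-$ passes strictly below $\mathbf p$, $C_0$ passes through $\mathbf p$, and the three curves agree outside a small neighborhood of $\mathbf p$ (in particular they have the same position — strictly above, strictly below, or on — relative to every lattice point other than $\mathbf p$). Then for every $N\ge1$, $$D^{(N)}_{C_+}=qt\,D^{(N)}_{C_-}+D^{(N)}_{C_0}\quad\text{in }\mathbf{S}\ddot{\mathbf H}_{N;q,t},$$ and $$D_{C_+}=qt\,D_{C_-}+D_{C_0}\quad\text{in }\mathbf{S}\ddot{\mathbf H}^{+}_{\infty;q,t}\cong\mathcal E^+_{q,t}.$$
   Context: DAHA. Let $N\ge1$. The double affine Hecke algebra $\ddot{\mathbf H}_{N;q,t}$ is the $\mathbb C(q^{1/2},t^{1/2})$-algebra generated by $X_i^{\pm1},Y_i^{\pm1}$ ($1\le i\le N$) and $T_i$ ($1\le i\le N-1$) subject to: $(T_i+t^{1/2})(T_i-t^{-1/2})=0$; $T_iT_{i+1}T_i=T_{i+1}T_iT_{i+1}$; $T_iT_k=T_kT_i$ if $|i-k|>1$; the $X_j$ pairwise commute and the $Y_j$ pairwise commute; $T_iX_iT_i=X_{i+1}$ and $T_i^{-1}Y_iT_i^{-1}=Y_{i+1}$; $T_iX_k=X_kT_i$ and $T_iY_k=Y_kT_i$ if $|i-k|>1$; $Y_1X_1X_2\cdots X_N=qX_1X_2\cdots X_NY_1$; $X_1^{-1}Y_2=Y_2X_1^{-1}T_1^{-2}$.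 For $w\in\mathfrak S_N$ with reduced word $s_{i_1}\cdots s_{i_\ell}$ set $T_w=T_{i_1}\cdots T_{i_\ell}$, and let $e_N=\big(\sum_{w}t^{-\ell(w)/2}T_w\big)/\big(\sum_{w}t^{-\ell(w)}\big)$ (sums over $\mathfrak S_N$), an idempotent with $T_ie_N=e_NT_i=t^{-1/2}e_N$. The spherical DAHA is $\mathbf{S}\ddot{\mathbf H}_{N;q,t}=e_N\ddot{\mathbf H}_{N;q,t}e_N$. Put $\gamma_{N;t}=1-t^N$. Curves. A monotone curve from $(0,0)$ to $(m,n)$ is the graph $C$ of a strictly increasing continuous $f:[0,m]\to[0,n]$ with $f(0)=0,f(m)=n$. Let $\mathcal P_C$ be the highest up-right lattice path from $(0,0)$ to $(m,n)$ weakly below $C$. Define $D_C^{(N)}$ as the product, in the order encountered traversing $\mathcal P_C$ from $(0,0)$ to $(m,n)$, of: $\gamma_{N;t}e_N$ for each lattice point of $C\cap\mathcal P_C$ other than $(m,n)$; $e_N$ for $(m,n)$; $Y_1$ for each up step; $Y_1X_1Y_1^{-1}$ for each right step. Limit. Automorphisms $\tau_\pm$ of $\ddot{\mathbf H}_{N;q,t}$: $\tau_+(T_i)=T_i$, $\tau_+(X_i)=X_i$, $\tau_+(Y_i)=Y_iX_i(T_{i-1}^{-1}\cdots T_1^{-1})(T_1^{-1}\cdots T_{i-1}^{-1})$; $\tau_-(T_i)=T_i$, $\tau_-(Y_i)=Y_i$, $\tau_-(X_i)=X_iY_i(T_{i-1}\cdots T_1)(T_1\cdots T_{i-1})$; they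 induce an $\mathrm{SL}_2(\mathbb Z)$-action on $\mathbf{S}\ddot{\mathbf H}_{N;q,t}$ via $\tau_+\mapsto\begin{pmatrix}1&1\\0&1\end{pmatrix}$, $\tau_-\mapsto\begin{pmatrix}1&0\\1&1\end{pmatrix}$. Set $P^{(N)}_{d,0}=q^de_N(\sum_iX_i^d)e_N$ for $d\ge1$ and $P^{(N)}_{a,b}=g(P^{(N)}_{d,0})$ for $(a,b)\ne0$, $d=\gcd(a,b)$, $g\in\mathrm{SL}_2(\mathbb Z)$ with $g(d,0)=(a,b)$. Let $\mathbf{S}\ddot{\mathbf H}^{+}_{N;q,t}$ be generated by $P^{(N)}_{\mathbf x}$ for $\mathbf x\in\{(a,b):a>0\}\cup\{(0,b):b>0\}$; there are surjections $\mathbf{S}\ddot{\mathbf H}^{+}_{N;q,t}\to\mathbf{S}\ddot{\mathbf H}^{+}_{N-1;q,t}$, $P^{(N)}_{\mathbf x}\mapsto P^{(N-1)}_{\mathbf x}$, and $\mathbf{S}\ddot{\mathbf H}^{+}_{\infty;q,t}$ is the projective limit (isomorphic to the positive elliptic Hall algebra $\mathcal E^+_{q,t}$). For each monotone curve $C$, $D_C\in\mathbf{S}\ddot{\mathbf H}^{+}_{\infty;q,t}$ denotes the (existing, unique) element whose image in each $\mathbf{S}\ddot{\mathbf H}^{+}_{N;q,t}$ is $D_C^{(N)}$. *)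

theory Defs
  imports
    "HOL-Analysis.Analysis"
    "HOL-Combinatorics.Permutations"
    "HOL-Computational_Algebra.Polynomial"
    "HOL-Computational_Algebra.Fraction_Field"
    "HOL-Library.Poly_Mapping"
    "HOL-Algebra.QuotRing"
    "HOL-Algebra.Subrings"
    "HOL-Algebra.Group_Action"
    "HOL-Algebra.Module"
begin

section \<open>The ground field\<close>

text \<open>The field of rational functions over the complex numbers in two independent
  variables, which are the square roots of \<open>q\<close> and \<open>t\<close>.\<close>

type_synonym scalar = "complex poly poly fract"

definition q_half :: scalar where "q_half = Fract [:[:0, 1:]:] 1"
definition t_half :: scalar where "t_half = Fract [:0, 1:] 1"
definition q_par :: scalar where "q_par = q_half ^ 2"
definition t_par :: scalar where "t_par = t_half ^ 2"

definition gamma_par :: "nat \<Rightarrow> scalar" where "gamma_par N = 1 - t_par ^ N"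


section \<open>The double affine Hecke algebra by generators and relations\<close>

text \<open>\<open>LXi i\<close> and \<open>LYi i\<close> are the letters for the inverses of \<open>X\<^sub>i\<close> and \<open>Y\<^sub>i\<close>.\<close>

datatype letter = LX nat | LXi nat | LY nat | LYi nat | LT nat

text \<open>Words form an additively written (non-commutative) monoid under concatenation, so that
  finitely supported functions on words, with the convolution product of
  \<^type>\<open>poly_mapping\<close>, are the free associative algebra on the letters.\<close>

datatype word = Word (letters: "letter list")

instantiation word :: monoid_add
begin
definition zero_word :: word where "0 = Word []"
definition plus_word :: "word \<Rightarrow> word \<Rightarrow> word" where "u + v = Word (letters u @ letters v)"
instance by standard (simp_all add: zero_word_def plus_word_def)
end

type_synonym free = "word \<Rightarrow>\<^sub>0 scalar"

definition sc :: "scalar \<Rightarrow> free" where "sc c = Poly_Mapping.single 0 c"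
definition gen :: "letter \<Rightarrow> free" where "gen a = Poly_Mapping.single (Word [a]) 1"

abbreviation "gX i \<equiv> gen (LX i)"
abbreviation "gXi i \<equiv> gen (LXi i)"
abbreviation "gY i \<equiv> gen (LY i)"
abbreviation "gYi i \<equiv> gen (LYi i)"
abbreviation "gT i \<equiv> gen (LT i)"

text \<open>By the quadratic relation this element represents the inverse of \<open>T\<^sub>i\<close>;
  see \<open>gTi_inverse\<close> below.\<close>

definition gTi :: "nat \<Rightarrow> free" where
  "gTi i = gT i + sc (t_half - inverse t_half)"

definition letters_of :: "nat \<Rightarrow> letter set" where
  "letters_of N = LX ` {1..N} \<union> LXi ` {1..N} \<union> LY ` {1..N} \<union> LYi ` {1..N} \<union> LT ` {1..<N}"

definition free_alg :: "nat \<Rightarrow> free ring" where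
  "free_alg N = \<lparr>carrier = {a. \<forall>w\<in>Poly_Mapping.keys a. set (letters w) \<subseteq> letters_of N},
     mult = (*), one = 1, zero = 0, add = (+)\<rparr>"

inductive daha_rel :: "nat \<Rightarrow> free \<Rightarrow> free \<Rightarrow> bool" for N where
  X_inv_right: "i \<in> {1..N} \<Longrightarrow> daha_rel N (gX i * gXi i) 1"
| X_inv_left: "i \<in> {1..N} \<Longrightarrow> daha_rel N (gXi i * gX i) 1"
| Y_inv_right: "i \<in> {1..N} \<Longrightarrow> daha_rel N (gY i * gYi i) 1"
| Y_inv_left: "i \<in> {1..N} \<Longrightarrow> daha_rel N (gYi i * gY i) 1"
| quadratic: "i \<in> {1..<N} \<Longrightarrow>
    daha_rel N ((gT i + sc t_half) * (gT i - sc (inverse t_half))) 0"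
| braid: "i \<in> {1..<N} \<Longrightarrow> i + 1 \<in> {1..<N} \<Longrightarrow>
    daha_rel N (gT i * gT (i + 1) * gT i) (gT (i + 1) * gT i * gT (i + 1))"
| T_comm: "i \<in> {1..<N} \<Longrightarrow> k \<in> {1..<N} \<Longrightarrow> \<bar>int i - int k\<bar> > 1 \<Longrightarrow>
    daha_rel N (gT i * gT k) (gT k * gT i)"
| X_comm: "i \<in> {1..N} \<Longrightarrow> k \<in> {1..N} \<Longrightarrow> daha_rel N (gX i * gX k) (gX k * gX i)"
| Y_comm: "i \<in> {1..N} \<Longrightarrow> k \<in> {1..N} \<Longrightarrow> daha_rel N (gY i * gY k) (gY k * gY i)"
| TXT: "i \<in> {1..<N} \<Longrightarrow> daha_rel N (gT i * gX i * gT i) (gX (i + 1))"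
| TYT: "i \<in> {1..<N} \<Longrightarrow> daha_rel N (gTi i * gY i * gTi i) (gY (i + 1))"
| TX_comm: "i \<in> {1..<N} \<Longrightarrow> k \<in> {1..N} \<Longrightarrow> \<bar>int i - int k\<bar> > 1 \<Longrightarrow>
    daha_rel N (gT i * gX k) (gX k * gT i)"
| TY_comm: "i \<in> {1..<N} \<Longrightarrow> k \<in> {1..N} \<Longrightarrow> \<bar>int i - int k\<bar> > 1 \<Longrightarrow>
    daha_rel N (gT i * gY k) (gY k * gT i)"
| Y1_X: "daha_rel N (gY 1 * prod_list (map gX [1..<N + 1]))
    (sc q_par * prod_list (map gX [1..<N + 1]) * gY 1)"
| X1i_Y2: "2 \<le> N \<Longrightarrow> daha_rel N (gXi 1 * gY 2) (gY 2 * gXi 1 * gTi 1 ^ 2)"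

definition daha_ideal :: "nat \<Rightarrow> free set" where
  "daha_ideal N = Idl\<^bsub>free_alg N\<^esub> {a - b | a b. daha_rel N a b}"

definition cls :: "nat \<Rightarrow> free \<Rightarrow> free set" where
  "cls N a = daha_ideal N +>\<^bsub>free_alg N\<^esub> a"

text \<open>Algebras are represented by the record of modules, whose scalar multiplication
  is written \<open>\<odot>\<close>.\<close>

definition DAHA :: "nat \<Rightarrow> (scalar, free set) module" where
  "DAHA N = (let Q = free_alg N Quot daha_ideal N in
     \<lparr>carrier = carrier Q, mult = mult Q, one = one Q, zero = zero Q, add = add Q,
      smult = (\<lambda>c h. cls N (sc c) \<otimes>\<^bsub>Q\<^esub> h)\<rparr>)"


section \<open>The spherical subalgebra\<close>

definition simple_perm :: "nat list \<Rightarrow> nat \<Rightarrow> nat" where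
  "simple_perm ks = foldr (\<lambda>i p. Transposition.transpose i (i + 1) \<circ> p) ks id"

definition reduced_word :: "nat \<Rightarrow> (nat \<Rightarrow> nat) \<Rightarrow> nat list \<Rightarrow> bool" where
  "reduced_word N w ks \<longleftrightarrow> set ks \<subseteq> {1..<N} \<and> simple_perm ks = w \<and>
     (\<forall>js. set js \<subseteq> {1..<N} \<and> simple_perm js = w \<longrightarrow> length ks \<le> length js)"

definition some_reduced_word :: "nat \<Rightarrow> (nat \<Rightarrow> nat) \<Rightarrow> nat list" where
  "some_reduced_word N w = (SOME ks. reduced_word N w ks)"

definition perm_length :: "nat \<Rightarrow> (nat \<Rightarrow> nat) \<Rightarrow> nat" where
  "perm_length N w = length (some_reduced_word N w)"

definition gTw :: "nat \<Rightarrow> (nat \<Rightarrow> nat) \<Rightarrow> free" where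
  "gTw N w = prod_list (map gT (some_reduced_word N w))"

definition ge :: "nat \<Rightarrow> free" where
  "ge N = sc (inverse (\<Sum>w | w permutes {1..N}. inverse t_par ^ perm_length N w)) *
     (\<Sum>w | w permutes {1..N}. sc (inverse t_half ^ perm_length N w) * gTw N w)"

definition SDAHA :: "nat \<Rightarrow> (scalar, free set) module" where
  "SDAHA N = (DAHA N)\<lparr>
     carrier := {cls N (ge N) \<otimes>\<^bsub>DAHA N\<^esub> h \<otimes>\<^bsub>DAHA N\<^esub> cls N (ge N) | h. h \<in> carrier (DAHA N)},
     one := cls N (ge N)\<rparr>"


section \<open>Monotone curves and lattice paths\<close>

definition monotone_curve :: "nat \<Rightarrow> nat \<Rightarrow> (real \<times> real) set \<Rightarrow> bool" where
  "monotone_curve m n C \<longleftrightarrow> (\<exists>f. continuous_on {0..real m} f \<and> strict_mono_on {0..real m} f \<and>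
     f 0 = 0 \<and> f (real m) = real n \<and> C = (\<lambda>x. (x, f x)) ` {0..real m})"

definition lattice_pt :: "int \<times> int \<Rightarrow> real \<times> real" where
  "lattice_pt p = (real_of_int (fst p), real_of_int (snd p))"

definition passes_above :: "(real \<times> real) set \<Rightarrow> real \<times> real \<Rightarrow> bool" where
  "passes_above C z \<longleftrightarrow> (\<exists>y. (fst z, y) \<in> C \<and> snd z < y)"

definition passes_below :: "(real \<times> real) set \<Rightarrow> real \<times> real \<Rightarrow> bool" where
  "passes_below C z \<longleftrightarrow> (\<exists>y. (fst z, y) \<in> C \<and> y < snd z)"

definition weakly_below :: "(real \<times> real) set \<Rightarrow> (real \<times> real) set \<Rightarrow> bool" where
  "weakly_below A B \<longleftrightarrow> (\<forall>(x, y)\<in>A. \<exists>y'. (x, y') \<in> B \<and> y \<le> y')"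

datatype step = Up | Rt

definition lattice_path :: "nat \<Rightarrow> nat \<Rightarrow> step list \<Rightarrow> bool" where
  "lattice_path m n s \<longleftrightarrow> count_list s Rt = m \<and> count_list s Up = n"

definition vertex :: "step list \<Rightarrow> nat \<Rightarrow> real \<times> real" where
  "vertex s k = (real (count_list (take k s) Rt), real (count_list (take k s) Up))"

definition path_points :: "step list \<Rightarrow> (real \<times> real) set" where
  "path_points s = (\<Union>k<length s. closed_segment (vertex s k) (vertex s (Suc k)))"

definition highest_path :: "nat \<Rightarrow> nat \<Rightarrow> (real \<times> real) set \<Rightarrow> step list" where
  "highest_path m n C = (THE s. lattice_path m n s \<and> weakly_below (path_points s) C \<and>
     (\<forall>s'. lattice_path m n s' \<and> weakly_below (path_points s') C \<longrightarrow>
        weakly_below (path_points s') (path_points s)))"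


section \<open>The elements attached to curves\<close>

fun gstep :: "step \<Rightarrow> free" where
  "gstep Up = gY 1"
| "gstep Rt = gY 1 * gX 1 * gYi 1"

text \<open>The vertices with index \<open>k < length s\<close> are the lattice points of the path other than
  its endpoint \<open>(m, n)\<close>; the latter contributes the final factor.\<close>

definition D_curve :: "nat \<Rightarrow> nat \<Rightarrow> nat \<Rightarrow> (real \<times> real) set \<Rightarrow> free set" where
  "D_curve N m n C = (let s = highest_path m n C in
     cls N (prod_list (map (\<lambda>k.
       (if vertex s k \<in> C then sc (gamma_par N) * ge N else 1) * gstep (s ! k)) [0..<length s])
       * ge N))"


section \<open>The stable limit\<close>

definition alg_hom ::
  "(scalar, 'a) module \<Rightarrow> (scalar, 'b) module \<Rightarrow> ('a \<Rightarrow> 'b) set" where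
  "alg_hom A B = {\<phi> \<in> ring_hom A B. \<phi> \<in> extensional (carrier A) \<and>
     (\<forall>c. \<forall>x\<in>carrier A. \<phi> (c \<odot>\<^bsub>A\<^esub> x) = c \<odot>\<^bsub>B\<^esub> \<phi> x)}"

definition alg_aut :: "(scalar, 'a) module \<Rightarrow> ('a \<Rightarrow> 'a) set" where
  "alg_aut A = {\<phi> \<in> alg_hom A A. bij_betw \<phi> (carrier A) (carrier A)}"

definition tau_plus :: "nat \<Rightarrow> free set \<Rightarrow> free set" where
  "tau_plus N = (THE \<phi>. \<phi> \<in> alg_aut (DAHA N) \<and>
     (\<forall>i\<in>{1..<N}. \<phi> (cls N (gT i)) = cls N (gT i)) \<and>
     (\<forall>i\<in>{1..N}. \<phi> (cls N (gX i)) = cls N (gX i)) \<and>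
     (\<forall>i\<in>{1..N}. \<phi> (cls N (gY i)) = cls N (gY i * gX i *
        prod_list (map gTi (rev [1..<i])) * prod_list (map gTi [1..<i]))))"

definition tau_minus :: "nat \<Rightarrow> free set \<Rightarrow> free set" where
  "tau_minus N = (THE \<phi>. \<phi> \<in> alg_aut (DAHA N) \<and>
     (\<forall>i\<in>{1..<N}. \<phi> (cls N (gT i)) = cls N (gT i)) \<and>
     (\<forall>i\<in>{1..N}. \<phi> (cls N (gY i)) = cls N (gY i)) \<and>
     (\<forall>i\<in>{1..N}. \<phi> (cls N (gX i)) = cls N (gX i * gY i *
        prod_list (map gT (rev [1..<i])) * prod_list (map gT [1..<i]))))"

definition SL2Z :: "(int ^ 2 ^ 2) monoid" where
  "SL2Z = \<lparr>carrier = {A. det A = 1}, mult = (**), one = mat 1\<rparr>"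

definition SL2Z_act :: "nat \<Rightarrow> int ^ 2 ^ 2 \<Rightarrow> free set \<Rightarrow> free set" where
  "SL2Z_act N = (THE \<rho>. \<rho> \<in> extensional (carrier SL2Z) \<and>
     group_action SL2Z (carrier (SDAHA N)) \<rho> \<and>
     (\<forall>g\<in>carrier SL2Z. \<rho> g \<in> alg_aut (SDAHA N)) \<and>
     \<rho> (vector [vector [1, 1], vector [0, 1]]) = restrict (tau_plus N) (carrier (SDAHA N)) \<and>
     \<rho> (vector [vector [1, 0], vector [1, 1]]) = restrict (tau_minus N) (carrier (SDAHA N)))"

definition P_row :: "nat \<Rightarrow> nat \<Rightarrow> free set" where
  "P_row N d = cls N (sc (q_par ^ d) * ge N * (\<Sum>i=1..N. gX i ^ d) * ge N)"

definition P_elt :: "nat \<Rightarrow> int \<times> int \<Rightarrow> free set" where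
  "P_elt N v = (let d = gcd (fst v) (snd v);
       g = (SOME g. g \<in> carrier SL2Z \<and> g *v vector [d, 0] = vector [fst v, snd v])
     in SL2Z_act N g (P_row N (nat d)))"

definition Z_plus :: "(int \<times> int) set" where
  "Z_plus = {(a, b). a > 0} \<union> {(0, b) | b. b > 0}"

definition SDAHA_plus :: "nat \<Rightarrow> (scalar, free set) module" where
  "SDAHA_plus N = (SDAHA N)\<lparr>carrier := \<Inter>{S. subring S (SDAHA N) \<and>
     (\<forall>c. \<forall>x\<in>S. c \<odot>\<^bsub>SDAHA N\<^esub> x \<in> S) \<and> P_elt N ` Z_plus \<subseteq> S}\<rparr>"

definition descend :: "nat \<Rightarrow> free set \<Rightarrow> free set" where
  "descend N = (THE \<phi>. \<phi> \<in> alg_hom (SDAHA_plus N) (SDAHA_plus (N - 1)) \<and>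
     \<phi> ` carrier (SDAHA_plus N) = carrier (SDAHA_plus (N - 1)) \<and>
     (\<forall>v\<in>Z_plus. \<phi> (P_elt N v) = P_elt (N - 1) v))"

text \<open>The projective limit over \<open>N \<ge> 1\<close>: compatible families, with componentwise operations.
  The image of a family \<open>d\<close> in the algebra with index \<open>N\<close> is \<open>d N\<close>.\<close>

definition SDAHA_inf :: "(scalar, nat \<Rightarrow> free set) module" where
  "SDAHA_inf =
     \<lparr>carrier = {d \<in> (\<Pi>\<^sub>E N\<in>{1..}. carrier (SDAHA_plus N)). \<forall>N\<ge>2. descend N (d N) = d (N - 1)},
      mult = (\<lambda>d d'. \<lambda>N\<in>{1..}. d N \<otimes>\<^bsub>SDAHA_plus N\<^esub> d' N),
      one = (\<lambda>N\<in>{1..}. \<one>\<^bsub>SDAHA_plus N\<^esub>),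
      zero = (\<lambda>N\<in>{1..}. \<zero>\<^bsub>SDAHA_plus N\<^esub>),
      add = (\<lambda>d d'. \<lambda>N\<in>{1..}. d N \<oplus>\<^bsub>SDAHA_plus N\<^esub> d' N),
      smult = (\<lambda>c d. \<lambda>N\<in>{1..}. c \<odot>\<^bsub>SDAHA_plus N\<^esub> d N)\<rparr>"

text \<open>The only family whose image for each \<open>N\<close> is \<open>D_curve N m n C\<close>. By \<open>D_inf_unique\<close> below it is
  the unique such element of the projective limit as soon as there is one.\<close>

definition D_inf :: "nat \<Rightarrow> nat \<Rightarrow> (real \<times> real) set \<Rightarrow> nat \<Rightarrow> free set" where
  "D_inf m n C = (\<lambda>N\<in>{1..}. D_curve N m n C)"

lemma D_inf_unique:
  assumes "d \<in> carrier SDAHA_inf" "\<And>N. N \<ge> 1 \<Longrightarrow> d N = D_curve N m n C"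
  shows "d = D_inf m n C"
  using assms by (auto simp: SDAHA_inf_def D_inf_def PiE_def extensional_def fun_eq_iff)


section \<open>Consistency checks\<close>

named_theorems free_closed

lemma free_algI: "(\<And>w. w \<in> Poly_Mapping.keys a \<Longrightarrow> set (letters w) \<subseteq> letters_of N) \<Longrightarrow>
    a \<in> carrier (free_alg N)"
  by (simp add: free_alg_def)

lemma free_algD: "a \<in> carrier (free_alg N) \<Longrightarrow> w \<in> Poly_Mapping.keys a \<Longrightarrow>
    set (letters w) \<subseteq> letters_of N"
  by (simp add: free_alg_def)

lemma sc_in [free_closed]: "sc c \<in> carrier (free_alg N)"
  by (simp add: free_alg_def sc_def zero_word_def)

lemma gen_in [free_closed]: "a \<in> letters_of N \<Longrightarrow> gen a \<in> carrier (free_alg N)"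
  by (simp add: free_alg_def gen_def)

lemma zero_in [free_closed]: "0 \<in> carrier (free_alg N)"
  by (simp add: free_alg_def)

lemma one_in [free_closed]: "1 \<in> carrier (free_alg N)"
  by (simp add: free_alg_def zero_word_def)

lemma uminus_in [free_closed]: "a \<in> carrier (free_alg N) \<Longrightarrow> - a \<in> carrier (free_alg N)"
  by (simp add: free_alg_def)

lemma add_in [free_closed]:
  assumes "a \<in> carrier (free_alg N)" "b \<in> carrier (free_alg N)"
  shows "a + b \<in> carrier (free_alg N)"
proof (rule free_algI)
  fix w assume "w \<in> Poly_Mapping.keys (a + b)"
  then have "w \<in> Poly_Mapping.keys a \<union> Poly_Mapping.keys b"
    using Poly_Mapping.keys_add[of a b] by auto
  then show "set (letters w) \<subseteq> letters_of N"
    using assms free_algD by blast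
qed

lemma diff_in [free_closed]:
  "a \<in> carrier (free_alg N) \<Longrightarrow> b \<in> carrier (free_alg N) \<Longrightarrow> a - b \<in> carrier (free_alg N)"
  using add_in[of a N "- b"] uminus_in[of b N] by simp

lemma mult_in [free_closed]:
  assumes "a \<in> carrier (free_alg N)" "b \<in> carrier (free_alg N)"
  shows "a * b \<in> carrier (free_alg N)"
proof (rule free_algI)
  fix w assume "w \<in> Poly_Mapping.keys (a * b)"
  then obtain u v where "w = u + v" "u \<in> Poly_Mapping.keys a" "v \<in> Poly_Mapping.keys b"
    using Poly_Mapping.keys_mult[of a b] by auto
  then show "set (letters w) \<subseteq> letters_of N"
    using free_algD[OF assms(1)] free_algD[OF assms(2)] by (simp add: plus_word_def)
qed

lemma power_in [free_closed]: "a \<in> carrier (free_alg N) \<Longrightarrow> a ^ k \<in> carrier (free_alg N)"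
  by (induction k) (auto intro: free_closed)

lemma prod_list_in [free_closed]:
  "set as \<subseteq> carrier (free_alg N) \<Longrightarrow> prod_list as \<in> carrier (free_alg N)"
  by (induction as) (auto intro: free_closed)

lemma gTi_in [free_closed]: "i \<in> {1..<N} \<Longrightarrow> gTi i \<in> carrier (free_alg N)"
  unfolding gTi_def by (intro free_closed) (auto simp: letters_of_def)

lemma free_alg_ops [simp]:
  "mult (free_alg N) = (*)" "one (free_alg N) = 1" "zero (free_alg N) = 0"
  "add (free_alg N) = (+)"
  by (simp_all add: free_alg_def)

lemma ring_free_alg: "ring (free_alg N)"
proof (intro ringI abelian_groupI monoidI)
  fix a assume "a \<in> carrier (free_alg N)"
  then show "\<exists>b\<in>carrier (free_alg N). b \<oplus>\<^bsub>free_alg N\<^esub> a = \<zero>\<^bsub>free_alg N\<^esub>"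
    by (intro bexI[of _ "- a"] uminus_in) auto
qed (simp_all add: add_in mult_in one_in zero_in algebra_simps)

lemma minus_free_alg:
  assumes "a \<in> carrier (free_alg N)" "b \<in> carrier (free_alg N)"
  shows "a \<ominus>\<^bsub>free_alg N\<^esub> b = a - b"
proof -
  interpret ring "free_alg N" by (rule ring_free_alg)
  have "\<ominus>\<^bsub>free_alg N\<^esub> b = - b"
    by (rule minus_equality) (use assms uminus_in in auto)
  then show ?thesis
    by (simp add: a_minus_def)
qed

lemma daha_rel_in:
  assumes "daha_rel N a b" "1 \<le> N"
  shows "a \<in> carrier (free_alg N)" "b \<in> carrier (free_alg N)"
  using assms by (induction rule: daha_rel.induct)
    (auto intro!: free_closed simp: letters_of_def)

lemma ideal_daha_ideal: "1 \<le> N \<Longrightarrow> ideal (daha_ideal N) (free_alg N)"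
  unfolding daha_ideal_def
  by (rule ring.genideal_ideal[OF ring_free_alg]) (auto dest: daha_rel_in intro!: diff_in)

lemma cls_eqI:
  assumes "daha_rel N c d" "a - b = c - d" "1 \<le> N"
    and "a \<in> carrier (free_alg N)" "b \<in> carrier (free_alg N)"
  shows "cls N a = cls N b"
proof -
  have "c - d \<in> daha_ideal N"
    unfolding daha_ideal_def
    by (rule subsetD[OF ring.genideal_self[OF ring_free_alg]])
      (use assms in \<open>auto dest: daha_rel_in intro!: diff_in\<close>)
  then show ?thesis
    using ring.quotient_eq_iff_same_a_r_cos[OF ring_free_alg ideal_daha_ideal, of N a b] assms
    by (simp add: cls_def minus_free_alg)
qed

lemma
  fixes N i :: nat
  assumes i: "i \<in> {1..<N}"
  shows gTi_inverse: "cls N (gT i * gTi i) = \<one>\<^bsub>DAHA N\<^esub>" "cls N (gTi i * gT i) = \<one>\<^bsub>DAHA N\<^esub>"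
proof -
  have N: "1 \<le> N" and T: "gT i \<in> carrier (free_alg N)"
    using i by (auto intro!: free_closed simp: letters_of_def)
  have t: "t_half \<noteq> 0"
    by (simp add: t_half_def Zero_fract_def eq_fract)
  have sc: "sc c * gT i = gT i * sc c" for c
    by (simp add: sc_def gen_def mult_single)
  have one: "sc t_half * sc (inverse t_half) = 1"
    using t by (simp add: sc_def mult_single)
  have diff: "sc (t_half - inverse t_half) = sc t_half - sc (inverse t_half)"
    by (simp add: sc_def single_diff)
  have prod: "(gT i + sc t_half) * (gT i - sc (inverse t_half)) =
      gT i * gT i + gT i * sc t_half - gT i * sc (inverse t_half) - 1"
    by (simp only: distrib_right right_diff_distrib sc one) simp
  have "gT i * gTi i - 1 = (gT i + sc t_half) * (gT i - sc (inverse t_half)) - 0"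
    unfolding prod gTi_def diff by (simp add: distrib_left right_diff_distrib)
  moreover have "gTi i * gT i - 1 = (gT i + sc t_half) * (gT i - sc (inverse t_half)) - 0"
    unfolding prod gTi_def diff by (simp add: distrib_right left_diff_distrib sc)
  moreover have "\<one>\<^bsub>DAHA N\<^esub> = cls N 1"
    by (simp add: DAHA_def FactRing_def cls_def)
  ultimately show "cls N (gT i * gTi i) = \<one>\<^bsub>DAHA N\<^esub>" "cls N (gTi i * gT i) = \<one>\<^bsub>DAHA N\<^esub>"
    using cls_eqI[OF daha_rel.quadratic[OF i] _ N mult_in[OF T gTi_in[OF i]] one_in]
      cls_eqI[OF daha_rel.quadratic[OF i] _ N mult_in[OF gTi_in[OF i] T] one_in]
    by simp_all
qed

text \<open>Changing a curve only inside a ball of radius at most 1 around a lattice point does not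
  affect its position relative to the other lattice points.\<close>

lemma same_position:
  assumes "monotone_curve m n C" "monotone_curve m n C'"
    and p: "lattice_pt p \<in> C'" "lattice_pt p \<notin> C" and r: "r \<le> 1"
    and eq: "C - ball (lattice_pt p) r = C' - ball (lattice_pt p) r" and "p' \<noteq> p"
  shows "passes_above C (lattice_pt p') \<longleftrightarrow> passes_above C' (lattice_pt p')"
    and "passes_below C (lattice_pt p') \<longleftrightarrow> passes_below C' (lattice_pt p')"
    and "lattice_pt p' \<in> C \<longleftrightarrow> lattice_pt p' \<in> C'"
proof -
  obtain a b a' b' where ab: "p = (a, b)" "p' = (a', b')"
    by (metis surj_pair)
  obtain f where C: "C = (\<lambda>x. (x, f x)) ` {0..real m}"
    using assms(1) by (auto simp: monotone_curve_def)
  obtain f' where C': "C' = (\<lambda>x. (x, f' x)) ` {0..real m}"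
    using assms(2) by (auto simp: monotone_curve_def)
  have ball: "\<bar>x - real_of_int a\<bar> < 1" "\<bar>y - real_of_int b\<bar> < 1"
    if "(x, y) \<in> ball (lattice_pt p) r" for x y
  proof -
    have d: "dist (lattice_pt p) (x, y) < 1"
      using that r by simp
    show "\<bar>x - real_of_int a\<bar> < 1"
      using d dist_fst_le[of "lattice_pt p" "(x, y)"] ab
      by (simp add: lattice_pt_def dist_real_def)
    show "\<bar>y - real_of_int b\<bar> < 1"
      using d dist_snd_le[of "lattice_pt p" "(x, y)"] ab
      by (simp add: lattice_pt_def dist_real_def)
  qed
  have off: "(x, y) \<in> C \<longleftrightarrow> (x, y) \<in> C'" if "\<bar>x - real_of_int a\<bar> \<ge> 1" for x y
    using eq ball(1)[of x y] that by force
  have "(passes_above C (lattice_pt p') \<longleftrightarrow> passes_above C' (lattice_pt p')) \<and>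
    (passes_below C (lattice_pt p') \<longleftrightarrow> passes_below C' (lattice_pt p')) \<and>
    (lattice_pt p' \<in> C \<longleftrightarrow> lattice_pt p' \<in> C')"
  proof (cases "a' = a")
    case False
    then have "\<bar>real_of_int a' - real_of_int a\<bar> \<ge> 1"
      by linarith
    then show ?thesis
      using off by (simp add: passes_above_def passes_below_def ab lattice_pt_def)
  next
    case True
    then have b: "b' \<noteq> b"
      using ab \<open>p' \<noteq> p\<close> by simp
    have a: "real_of_int a \<in> {0..real m}" and f': "f' (real_of_int a) = real_of_int b"
      using p(1) C' ab by (auto simp: lattice_pt_def)
    have on: "(real_of_int a, y) \<in> C \<longleftrightarrow> y = f (real_of_int a)"
      "(real_of_int a, y) \<in> C' \<longleftrightarrow> y = real_of_int b" for y
      using a f' unfolding C C' by auto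
    have "f (real_of_int a) \<noteq> real_of_int b"
      using p(2) on(1)[of "real_of_int b"] ab by (auto simp: lattice_pt_def)
    then have "(real_of_int a, f (real_of_int a)) \<in> ball (lattice_pt p) r"
      using eq on by blast
    then have "\<bar>f (real_of_int a) - real_of_int b\<bar> < 1"
      by (rule ball(2))
    moreover have "real_of_int b' \<ge> real_of_int b + 1 \<or> real_of_int b' \<le> real_of_int b - 1"
      using b by linarith
    ultimately show ?thesis
      using True by (auto simp: passes_above_def passes_below_def ab lattice_pt_def on)
  qed
  then show "passes_above C (lattice_pt p') \<longleftrightarrow> passes_above C' (lattice_pt p')"
    and "passes_below C (lattice_pt p') \<longleftrightarrow> passes_below C' (lattice_pt p')"
    and "lattice_pt p' \<in> C \<longleftrightarrow> lattice_pt p' \<in> C'"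
    by blast+
qed

end

theory Submission
  imports Defs
begin

text \<open>Near the lattice point, both \<open>C\<^sub>+\<close> and \<open>C\<^sub>0\<close> have a highest path that goes up and then right,
  while that of \<open>C\<^sub>-\<close> goes right and then up. So the identity amounts to
  \<open>Y\<^sub>1 X\<^sub>1 Y\<^sub>1\<^sup>-\<^sup>1 R = q t X\<^sub>1 R + (1 - t\<^sup>N) e Y\<^sub>1 X\<^sub>1 Y\<^sub>1\<^sup>-\<^sup>1 R\<close>, where \<open>R\<close> is the rest of the product. Now \<open>R\<close> is
  built from \<open>X\<^sub>1\<close>, \<open>Y\<^sub>1\<close>, \<open>Y\<^sub>1\<^sup>-\<^sup>1\<close> and \<open>e\<close> and ends in \<open>e\<close>, hence is symmetric under \<open>T\<^sub>2, \<dots>, T\<^sub>N\<^sub>-\<^sub>1\<close>; so is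
  \<open>u = Y\<^sub>1 X\<^sub>1 Y\<^sub>1\<^sup>-\<^sup>1 R\<close>. With \<open>J = T\<^sub>1\<^sup>-\<^sup>1 \<cdots> T\<^sub>N\<^sub>-\<^sub>1\<^sup>-\<^sup>1 T\<^sub>N\<^sub>-\<^sub>1\<^sup>-\<^sup>1 \<cdots> T\<^sub>1\<^sup>-\<^sup>1\<close> the defining relations give
  \<open>J Y\<^sub>1 X\<^sub>1 = q X\<^sub>1 Y\<^sub>1\<close>, so that \<open>J u = q X\<^sub>1 R\<close>. Finally \<open>u - t J u\<close> turns out to be symmetric under all
  \<open>T\<^sub>i\<close>; applying \<open>e\<close>, which absorbs \<open>J\<close> as \<open>t\<^sup>N\<^sup>-\<^sup>1\<close>, yields \<open>u - t J u = (1 - t\<^sup>N) e u\<close>.\<close>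

section \<open>Reduced words in the symmetric group\<close>

lemma simple_perm_simps:
  "simple_perm [] = id"
  "simple_perm (i # ks) = Transposition.transpose i (Suc i) \<circ> simple_perm ks"
  by (simp_all add: simple_perm_def)

lemma simple_perm_append: "simple_perm (ks @ js) = simple_perm ks \<circ> simple_perm js"
  by (induction ks) (simp_all only: append.simps simple_perm_simps comp_assoc id_o)

lemma simple_transposition_permutes:
  "i \<in> {1..<N} \<Longrightarrow> Transposition.transpose i (Suc i) permutes {1..N}"
  by (rule permutes_swap_id) auto

lemma simple_perm_permutes: "set ks \<subseteq> {1..<N} \<Longrightarrow> simple_perm ks permutes {1..N}"
  by (induction ks)
    (auto simp: simple_perm_simps simp del: One_nat_def intro!: permutes_compose simple_transposition_permutes permutes_id)

section \<open>Inversions and the length of a permutation\<close>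

definition inversions :: "nat \<Rightarrow> (nat \<Rightarrow> nat) \<Rightarrow> (nat \<times> nat) set" where
  "inversions N w = {(a, b). a \<in> {1..N} \<and> b \<in> {1..N} \<and> a < b \<and> w b < w a}"

lemma finite_inversions: "finite (inversions N w)"
  by (rule finite_subset[of _ "{1..N} \<times> {1..N}"]) (auto simp: inversions_def)

lemma inversions_id [simp]: "inversions N id = {}" "inversions N (\<lambda>a. a) = {}"
  by (auto simp: inversions_def)

text \<open>No integer lies strictly between \<open>i\<close> and \<open>Suc i\<close>, so
  exchanging these two values can reverse the order of that pair only.\<close>

lemma transpose_less_iff:
  assumes "{c, d} \<noteq> {i, Suc i}"
  shows "Transposition.transpose i (Suc i) c < Transposition.transpose i (Suc i) d \<longleftrightarrow> c < d"
  using assms by (auto simp: Transposition.transpose_def)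

abbreviation pinv :: "(nat \<Rightarrow> nat) \<Rightarrow> nat \<Rightarrow> nat" where
  "pinv w \<equiv> inv_into UNIV w"

lemma inv_transpose_comp:
  assumes "w permutes S"
  shows "pinv (Transposition.transpose i j \<circ> w) x = pinv w (Transposition.transpose i j x)"
  using permutes_bij[OF assms] by (simp add: o_inv_distrib bij_is_inj bij_is_surj)

lemma transpose_comp_cancel:
  "Transposition.transpose i j \<circ> (Transposition.transpose i j \<circ> w) = w"
  by (simp add: fun_eq_iff)

text \<open>Composing with the transposition on the left exchanges the values \<open>i\<close> and
  \<open>Suc i\<close>, which stand at the positions \<open>pinv w i\<close> and
  \<open>pinv w (Suc i)\<close>. These two positions become a new inversion; every other pair of
  positions keeps its order.\<close>

lemma card_inversions_ascent:
  assumes w: "w permutes {1..N}" and i: "i \<in> {1..<N}" and less: "pinv w i < pinv w (Suc i)"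
  shows "card (inversions N (Transposition.transpose i (Suc i) \<circ> w)) = Suc (card (inversions N w))"
proof -
  let ?x = "pinv w i" and ?y = "pinv w (Suc i)"
  have wx: "w ?x = i" "w ?y = Suc i"
    using permutes_inverses[OF w] by auto
  have xy: "?x \<in> {1..N}" "?y \<in> {1..N}"
    using permutes_in_image[OF permutes_inv[OF w]] i by auto
  have inj: "w a = w b \<longleftrightarrow> a = b" for a b
    using permutes_inj[OF w] by (simp add: inj_eq)
  have "inversions N (Transposition.transpose i (Suc i) \<circ> w) = insert (?x, ?y) (inversions N w)"
  proof (rule Set.set_eqI)
    fix ab :: "nat \<times> nat"
    obtain a b where [simp]: "ab = (a, b)" by (cases ab)
    have "(a, b) \<in> inversions N (Transposition.transpose i (Suc i) \<circ> w) \<longleftrightarrow>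
        (a, b) \<in> insert (?x, ?y) (inversions N w)"
    proof (cases "{w b, w a} = {i, Suc i}")
      case True
      then consider "w a = w ?x" "w b = w ?y" | "w a = w ?y" "w b = w ?x"
        unfolding wx doubleton_eq_iff by blast
      then show ?thesis
      proof cases
        case 1
        then have "a = ?x" "b = ?y"
          unfolding inj by simp_all
        then show ?thesis
          using less xy wx by (simp add: inversions_def)
      next
        case 2
        then have "a = ?y" "b = ?x"
          unfolding inj by simp_all
        then show ?thesis
          using less wx by (simp add: inversions_def)
      qed
    next
      case False
      then have "(a, b) \<noteq> (?x, ?y)"
        using wx by auto
      then show ?thesis
        using transpose_less_iff[OF False] by (auto simp: inversions_def)
    qed
    then show "ab \<in> inversions N (Transposition.transpose i (Suc i) \<circ> w) \<longleftrightarrow>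
        ab \<in> insert (?x, ?y) (inversions N w)" by simp
  qed
  moreover have "(?x, ?y) \<notin> inversions N w"
    using wx by (simp add: inversions_def)
  ultimately show ?thesis
    by (simp add: finite_inversions)
qed

lemma card_inversions_descent:
  assumes w: "w permutes {1..N}" and i: "i \<in> {1..<N}" and less: "pinv w (Suc i) < pinv w i"
  shows "card (inversions N w) = Suc (card (inversions N (Transposition.transpose i (Suc i) \<circ> w)))"
  using card_inversions_ascent[OF permutes_compose[OF w simple_transposition_permutes[OF i]] i] less
  unfolding inv_transpose_comp[OF w] transpose_comp_cancel by simp

lemma inv_neq_Suc:
  assumes "w permutes S"
  shows "pinv w i \<noteq> pinv w (Suc i)"
  using inj_eq[OF permutes_inj[OF permutes_inv[OF assms]]] by simp

text \<open>If the positions \<open>pinv w i\<close> increase with \<open>i\<close>, then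
  \<open>pinv w\<close> is bounded below by the identity on \<open>{1..N}\<close>, which for a
  permutation forces equality.\<close>

lemma permutes_without_descent:
  assumes w: "w permutes {1..N}" and asc: "\<And>i. i \<in> {1..<N} \<Longrightarrow> pinv w i < pinv w (Suc i)"
  shows "w = id"
proof -
  have u: "pinv w permutes {1..N}"
    by (rule permutes_inv[OF w])
  have "Suc j \<le> pinv w (Suc j)" if "Suc j \<in> {1..N}" for j
    using that
  proof (induction j)
    case 0
    then show ?case using permutes_in_image[OF u, of 1] by auto
  next
    case (Suc j)
    then show ?case using asc[of "Suc j"] by auto
  qed
  then have "\<forall>i\<in>{1..N}. i \<le> pinv w i"
    by (metis Suc_le_D atLeastAtMost_iff One_nat_def)
  then have "pinv w = id"
    by (intro permutes_natset_ge[OF u]) auto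
  then show ?thesis
    using permutes_inv_inv[OF w] by (metis inv_id)
qed

text \<open>Sorting: as long as some value \<open>Suc i\<close> stands to the left of
  \<open>i\<close>, exchanging the two removes exactly one inversion and contributes one letter.
  Without such a pair the permutation is the identity.\<close>

lemma ex_word_of_length_inversions:
  assumes "w permutes {1..N}"
  shows "\<exists>ks. set ks \<subseteq> {1..<N} \<and> simple_perm ks = w \<and> length ks = card (inversions N w)"
  using assms
proof (induction "card (inversions N w)" arbitrary: w rule: less_induct)
  case less
  show ?case
  proof (cases "\<exists>i\<in>{1..<N}. pinv w (Suc i) < pinv w i")
    case True
    then obtain i where i: "i \<in> {1..<N}" "pinv w (Suc i) < pinv w i" by blast
    let ?v = "Transposition.transpose i (Suc i) \<circ> w"
    note c = card_inversions_descent[OF less.prems i]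
    obtain ks where "set ks \<subseteq> {1..<N}" "simple_perm ks = ?v" "length ks = card (inversions N ?v)"
      using less.hyps[of ?v] c permutes_compose[OF less.prems simple_transposition_permutes[OF i(1)]]
      by auto
    then show ?thesis
      using c i by (intro exI[of _ "i # ks"]) (simp add: simple_perm_simps transpose_comp_cancel)
  next
    case False
    then have "w = id"
      by (intro permutes_without_descent[OF less.prems])
        (use inv_neq_Suc[OF less.prems] in \<open>metis linorder_neqE_nat\<close>)
    then show ?thesis
      by (intro exI[of _ "[]"]) (simp add: simple_perm_simps)
  qed
qed

lemma card_inversions_le_length:
  "set ks \<subseteq> {1..<N} \<Longrightarrow> card (inversions N (simple_perm ks)) \<le> length ks"
proof (induction ks)
  case Nil
  then show ?case by (simp add: simple_perm_simps)
next
  case (Cons i ks)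
  then have w: "simple_perm ks permutes {1..N}" and i: "i \<in> {1..<N}"
    by (auto simp del: One_nat_def intro: simple_perm_permutes)
  have "card (inversions N (simple_perm (i # ks))) \<le> Suc (card (inversions N (simple_perm ks)))"
    unfolding simple_perm_simps
    using card_inversions_ascent[OF w i] card_inversions_descent[OF w i] inv_neq_Suc[OF w, of i]
    by (cases "pinv (simple_perm ks) i < pinv (simple_perm ks) (Suc i)") simp_all
  then show ?case
    using Cons by simp
qed

text \<open>The two bounds above identify the minimal length with the number of inversions, so that
  minimality over all words becomes a count.\<close>

lemma reduced_word_iff:
  assumes "w permutes {1..N}"
  shows "reduced_word N w ks \<longleftrightarrow>
    set ks \<subseteq> {1..<N} \<and> simple_perm ks = w \<and> length ks = card (inversions N w)"
proof -
  obtain js where "set js \<subseteq> {1..<N}" "simple_perm js = w" "length js = card (inversions N w)"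
    using ex_word_of_length_inversions[OF assms] by blast
  then show ?thesis
    using card_inversions_le_length[of _ N] unfolding reduced_word_def by (metis le_antisym)
qed

lemma reduced_word_permutes: "reduced_word N w ks \<Longrightarrow> w permutes {1..N}"
  using simple_perm_permutes by (auto simp: reduced_word_def)

lemma some_reduced_word:
  "w permutes {1..N} \<Longrightarrow> reduced_word N w (some_reduced_word N w)"
  unfolding some_reduced_word_def
  by (rule someI_ex) (simp only: reduced_word_iff ex_word_of_length_inversions)

lemma perm_length_eq_card_inversions:
  "w permutes {1..N} \<Longrightarrow> perm_length N w = card (inversions N w)"
  unfolding perm_length_def by (metis some_reduced_word reduced_word_iff)

text \<open>A first letter \<open>i\<close> changes the number of inversions by one in either
  direction, and only a descent is compatible with minimal length. Thus the first letters of reduced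
  words are the left descents.\<close>

lemma reduced_word_Cons:
  assumes "w permutes {1..N}"
  shows "reduced_word N w (i # ks) \<longleftrightarrow> i \<in> {1..<N} \<and> pinv w (Suc i) < pinv w i \<and>
    reduced_word N (Transposition.transpose i (Suc i) \<circ> w) ks"
proof (cases "i \<in> {1..<N}")
  case True
  let ?v = "Transposition.transpose i (Suc i) \<circ> w"
  have v: "?v permutes {1..N}"
    by (rule permutes_compose[OF assms simple_transposition_permutes[OF True]])
  have eq: "simple_perm (i # ks) = w \<longleftrightarrow> simple_perm ks = ?v"
    unfolding simple_perm_simps by (metis transpose_comp_cancel)
  show ?thesis
  proof (cases "pinv w i < pinv w (Suc i)")
    case less: True
    then show ?thesis
      unfolding reduced_word_iff[OF assms] reduced_word_iff[OF v]
      using card_inversions_ascent[OF assms True less] card_inversions_le_length[of ks N] eq by auto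
  next
    case False
    then have "pinv w (Suc i) < pinv w i"
      using inv_neq_Suc[OF assms, of i] by simp
    then show ?thesis
      unfolding reduced_word_iff[OF assms] reduced_word_iff[OF v]
      using card_inversions_descent[OF assms True] True eq by auto
  qed
qed (auto simp: reduced_word_iff[OF assms])

text \<open>Reading a word backwards gives a word for the inverse. This yields one inequality for
  every permutation; applying it to the inverse as well yields equality.\<close>

lemma perm_length_inv:
  assumes "w permutes {1..N}"
  shows "perm_length N (pinv w) = perm_length N w"
proof -
  have rev: "simple_perm (rev ks) = pinv (simple_perm ks)" if "set ks \<subseteq> {1..<N}" for ks
    using that
  proof (induction ks)
    case (Cons i ks)
    then have "bij (simple_perm ks)"
      using permutes_bij[OF simple_perm_permutes[of ks N]] by simp
    then have "pinv (Transposition.transpose i (Suc i) \<circ> simple_perm ks) =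
        pinv (simple_perm ks) \<circ> Transposition.transpose i (Suc i)"
      by (subst o_inv_distrib) (simp_all add: bij_is_inj bij_is_surj)
    moreover have "simple_perm (rev ks) = pinv (simple_perm ks)"
      using Cons by simp
    ultimately show ?case
      by (simp only: rev.simps simple_perm_append simple_perm_simps o_id)
  qed (simp add: simple_perm_simps)
  have le: "perm_length N (pinv v) \<le> perm_length N v" if v: "v permutes {1..N}" for v
    using some_reduced_word[OF v] some_reduced_word[OF permutes_inv[OF v]] rev
    unfolding reduced_word_def perm_length_def by (metis length_rev set_rev)
  show ?thesis
    using le[OF assms] le[OF permutes_inv[OF assms]] permutes_inv_inv[OF assms] by simp
qed

lemma perm_length_transpose_left:
  assumes w: "w permutes {1..N}" and i: "i \<in> {1..<N}"
  shows "perm_length N (Transposition.transpose i (Suc i) \<circ> w) = Suc (perm_length N w) \<or>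
    perm_length N w = Suc (perm_length N (Transposition.transpose i (Suc i) \<circ> w))"
  unfolding perm_length_eq_card_inversions[OF w]
    perm_length_eq_card_inversions[OF permutes_compose[OF w simple_transposition_permutes[OF i]]]
  using card_inversions_ascent[OF assms] card_inversions_descent[OF assms] inv_neq_Suc[OF w, of i]
    linorder_neqE_nat by blast

lemma perm_length_transpose_right:
  assumes w: "w permutes {1..N}" and i: "i \<in> {1..<N}"
  shows "perm_length N (w \<circ> Transposition.transpose i (Suc i)) = Suc (perm_length N w) \<or>
    perm_length N w = Suc (perm_length N (w \<circ> Transposition.transpose i (Suc i)))"
proof -
  have "pinv (w \<circ> Transposition.transpose i (Suc i)) = Transposition.transpose i (Suc i) \<circ> pinv w"
    using permutes_bij[OF w] by (simp add: o_inv_distrib bij_is_inj bij_is_surj)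
  then show ?thesis
    using perm_length_transpose_left[OF permutes_inv[OF w] i] perm_length_inv[OF w]
      perm_length_inv[OF permutes_compose[OF simple_transposition_permutes[OF i] w]]
    by simp
qed

section \<open>Matsumoto's theorem\<close>

text \<open>Matsumoto's theorem concerns multiplication only, so it is set in a monoid; both the
  Hecke generators and their inverses become instances.\<close>

locale braid_relations =
  fixes T :: "nat \<Rightarrow> 'a::monoid_mult" and N :: nat
  assumes braid: "1 \<le> i \<Longrightarrow> Suc i < N \<Longrightarrow> T i * (T (Suc i) * T i) = T (Suc i) * (T i * T (Suc i))"
    and far_comm: "1 \<le> i \<Longrightarrow> Suc i < j \<Longrightarrow> j < N \<Longrightarrow> T i * T j = T j * T i"
begin

abbreviation word_prod :: "nat list \<Rightarrow> 'a" where
  "word_prod ks \<equiv> prod_list (map T ks)"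

text \<open>Two left descents allow a reduced word starting with the longest element of the subgroup
  generated by both transpositions: \<open>i j i\<close> or \<open>j i j\<close> for adjacent
  indices, \<open>i j\<close> or \<open>j i\<close> otherwise. With a common tail \<open>ks\<close>,
  the equality of products is one braid or commutation relation.\<close>

lemma ex_reduced_word_common:
  assumes w: "w permutes {1..N}" and i: "i \<in> {1..<N}" and j: "j \<in> {1..<N}" and "i < j"
    and di: "pinv w (Suc i) < pinv w i" and dj: "pinv w (Suc j) < pinv w j"
  shows "\<exists>ls js. reduced_word N w (i # ls) \<and> reduced_word N w (j # js) \<and>
    word_prod (i # ls) = word_prod (j # js)"
proof -
  let ?s = "\<lambda>k. Transposition.transpose k (Suc k) :: nat \<Rightarrow> nat"
  have p: "?s k \<circ> u permutes {1..N}" if "u permutes {1..N}" "k = i \<or> k = j" for u k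
    using permutes_compose[OF that(1) simple_transposition_permutes] i j that(2) by blast
  note p1 = p[OF w] and p2 = p[OF p[OF w]]
  note inv_simps = inv_transpose_comp[OF w] inv_transpose_comp[OF p1] inv_transpose_comp[OF p2]
  note red_simps = reduced_word_Cons[OF w] reduced_word_Cons[OF p1] reduced_word_Cons[OF p2]
  show ?thesis
  proof (cases "j = Suc i")
    case True
    let ?v = "?s i \<circ> (?s j \<circ> (?s i \<circ> w))"
    have v: "?v permutes {1..N}"
      by (intro p w) auto
    have s: "?s i (Suc (Suc i)) = Suc (Suc i)" "?s (Suc i) i = i"
      by (simp_all add: Transposition.transpose_def)
    \<comment> \<open>The braid relation between transpositions lets the same tail complete both
      words.\<close>
    have v': "?v = ?s j \<circ> (?s i \<circ> (?s j \<circ> w))"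
      using True by (auto simp: fun_eq_iff Transposition.transpose_def)
    obtain ks where ks: "reduced_word N ?v ks"
      using some_reduced_word[OF v] by blast
    have "reduced_word N w (i # j # i # ks)"
      using ks i j di dj by (simp add: red_simps inv_simps s True del: One_nat_def)
    moreover have "reduced_word N w (j # i # j # ks)"
      using ks[unfolded v'] i j di dj True by (simp add: red_simps inv_simps s del: One_nat_def)
    moreover have "word_prod (i # j # i # ks) = word_prod (j # i # j # ks)"
      using braid[of i] True i j by (simp flip: mult.assoc)
    ultimately show ?thesis
      by blast
  next
    case False
    then have ij: "Suc i < j"
      using \<open>i < j\<close> by simp
    let ?v = "?s j \<circ> (?s i \<circ> w)"
    have v: "?v permutes {1..N}"
      by (intro p w) auto
    have s: "?s i j = j" "?s i (Suc j) = Suc j" "?s j i = i" "?s j (Suc i) = Suc i"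
      using ij by (simp_all add: Transposition.transpose_def)
    have v': "?v = ?s i \<circ> (?s j \<circ> w)"
      using ij by (auto simp: fun_eq_iff Transposition.transpose_def)
    obtain ks where ks: "reduced_word N ?v ks"
      using some_reduced_word[OF v] by blast
    have "reduced_word N w (i # j # ks)"
      using ks i j di dj by (simp add: red_simps inv_simps s del: One_nat_def)
    moreover have "reduced_word N w (j # i # ks)"
      using ks[unfolded v'] i j di dj by (simp add: red_simps inv_simps s del: One_nat_def)
    moreover have "word_prod (i # j # ks) = word_prod (j # i # ks)"
      using far_comm[of i j] ij i j by (simp flip: mult.assoc)
    ultimately show ?thesis
      by blast
  qed
qed

text \<open>Induction on the length. If the first letters agree, they are deleted. If they differ,
  two words from \<open>ex_reduced_word_common\<close> are interposed; each shares its first letter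
  with one of the given words.\<close>

theorem matsumoto:
  assumes "reduced_word N w ks" "reduced_word N w js"
  shows "word_prod ks = word_prod js"
  using assms
proof (induction "length ks" arbitrary: w ks js)
  case 0
  then show ?case
    using reduced_word_iff[OF reduced_word_permutes[OF "0.prems"(1)]] by (metis length_0_conv)
next
  case (Suc l)
  note w = reduced_word_permutes[OF Suc.prems(1)]
  obtain i ks' where ks: "ks = i # ks'" and l: "length ks' = l"
    using Suc.hyps(2) by (metis length_Suc_conv)
  have "length js = length ks"
    using Suc.prems reduced_word_iff[OF w] by simp
  then obtain j js' where js: "js = j # js'" and l': "length js' = l"
    using Suc.hyps(2) by (metis length_Suc_conv)
  have same: "word_prod (k # ls) = word_prod (k # ls')"
    if r: "reduced_word N w (k # ls)" "reduced_word N w (k # ls')" and "length ls = l" for k ls ls'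
    using Suc.hyps(1)[of ls _ ls'] that reduced_word_Cons[OF w] by auto
  note i = reduced_word_Cons[OF w, THEN iffD1, OF Suc.prems(1)[unfolded ks]]
  note j = reduced_word_Cons[OF w, THEN iffD1, OF Suc.prems(2)[unfolded js]]
  consider "i = j" | "i < j" | "j < i" by linarith
  then show ?case
  proof cases
    case 1
    then show ?thesis
      using same Suc.prems ks js l by blast
  next
    case 2
    then obtain ls ls' where "reduced_word N w (i # ls)" "reduced_word N w (j # ls')"
      "word_prod (i # ls) = word_prod (j # ls')"
      using ex_reduced_word_common[OF w] i j by blast
    then show ?thesis
      using same[of i ks' ls] same[of j js' ls'] Suc.prems ks js l l' by simp
  next
    case 3
    then obtain ls ls' where "reduced_word N w (j # ls)" "reduced_word N w (i # ls')"
      "word_prod (j # ls) = word_prod (i # ls')"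
      using ex_reduced_word_common[OF w] i j by blast
    then show ?thesis
      using same[of i ks' ls'] same[of j js' ls] Suc.prems ks js l l' by simp
  qed
qed

end

section \<open>Hecke algebras\<close>

text \<open>Products are kept nested to the right, so a relation has to be applied in front of a
  tail \<open>z\<close>; this lemma and the next bring it into that form.\<close>

lemma mult_eq_extend:
  fixes a b c z :: "'a::semigroup_mult"
  shows "a * b = c \<Longrightarrow> a * (b * z) = c * z"
  by (simp flip: mult.assoc)

lemma mult_eq_extend2:
  fixes a b c d z :: "'a::semigroup_mult"
  shows "a * (b * c) = d \<Longrightarrow> a * (b * (c * z)) = d * z"
  by (simp flip: mult.assoc)

lemma commutes_inverse:
  fixes x y y' :: "'a::monoid_mult"
  assumes "x * y = y * x" "y * y' = 1" "y' * y = 1"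
  shows "x * y' = y' * x"
  by (metis assms mult.assoc mult_1_left mult_1_right)

lemma left_right_inverse_unique:
  fixes x y u :: "'a::monoid_mult"
  assumes "x * u = 1" "u * y = 1"
  shows "x = y"
  by (metis assms mult.assoc mult_1_left mult_1_right)

text \<open>The hypothesis \<open>comm\<close> says that \<open>a\<close> commutes with
  \<open>b a x a b\<close>. The braid relation turns its two sides into \<open>b a b x a b\<close>
  and \<open>b a x b a b\<close>, where \<open>b a\<close> cancels on the left and
  \<open>a b\<close> on the right.\<close>

lemma commutes_of_braid_conjugate:
  fixes a b a' b' x :: "'a::monoid_mult"
  assumes inv: "a' * a = 1" "a * a' = 1" "b' * b = 1" "b * b' = 1"
    and braid: "a * (b * a) = b * (a * b)"
    and comm: "a * (b * (a * (x * (a * b)))) = b * (a * (x * (a * (b * a))))"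
  shows "b * x = x * b"
proof -
  have "b * (a * (b * (x * (a * b)))) = b * (a * (x * (b * (a * b))))"
    using comm by (simp add: mult.assoc braid mult_eq_extend2[OF braid])
  then have "a' * (b' * (b * (a * (b * (x * (a * b)))))) * (b' * a') =
      a' * (b' * (b * (a * (x * (b * (a * b)))))) * (b' * a')"
    by simp
  then show ?thesis
    by (simp add: mult.assoc inv inv[THEN mult_eq_extend])
qed

text \<open>The involution pairs each index satisfying \<open>P\<close> with one that does not. This
  serves to group permutations that differ by one transposition.\<close>

lemma sum_involution:
  fixes f :: "'b \<Rightarrow> 'a::comm_monoid_add"
  assumes "finite W" and inv: "\<And>w. w \<in> W \<Longrightarrow> \<phi> w \<in> W" "\<And>w. w \<in> W \<Longrightarrow> \<phi> (\<phi> w) = w"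
    and P: "\<And>w. w \<in> W \<Longrightarrow> P (\<phi> w) \<longleftrightarrow> \<not> P w"
  shows "sum f W = (\<Sum>w | w \<in> W \<and> P w. f w + f (\<phi> w))"
proof -
  have "sum f W = sum f {w \<in> W. P w} + sum f {w \<in> W. \<not> P w}"
    using assms(1) by (subst sum.union_disjoint[symmetric]) (auto intro: sum.cong)
  also have "{w \<in> W. \<not> P w} = \<phi> ` {w \<in> W. P w}"
    using inv P by (auto simp: image_iff) (metis)
  also have "sum f (\<phi> ` {w \<in> W. P w}) = (\<Sum>w | w \<in> W \<and> P w. f (\<phi> w))"
    by (subst sum.reindex) (auto intro!: inj_onI dest: inv(2), metis inv(2))
  finally show ?thesis
    by (simp add: sum.distrib)
qed

text \<open>The sort \<open>{ring, monoid_mult}\<close> is that of unital rings in which 0 = 1 is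
  permitted, so that it covers a ring given by relations without a proof that it is
  nontrivial.\<close>

locale central_scalars =
  fixes emb :: "'k::field \<Rightarrow> 'a::{ring, monoid_mult}"
  assumes emb_add: "emb (a + b) = emb a + emb b"
    and emb_mult: "emb (a * b) = emb a * emb b"
    and emb_one: "emb 1 = 1"
    and emb_central: "emb c * x = x * emb c"
begin

lemma emb_zero: "emb 0 = 0"
  using emb_add[of 0 0] by simp

lemma emb_diff: "emb (a - b) = emb a - emb b"
  using emb_add[of "a - b" b] by simp

lemma emb_sum: "emb (sum f A) = (\<Sum>x\<in>A. emb (f x))"
  by (induction A rule: infinite_finite_induct) (simp_all add: emb_zero emb_add)

lemma emb_left: "x * (emb c * y) = emb c * (x * y)"
  by (metis emb_central mult.assoc)

lemma emb_emb: "emb a * (emb b * x) = emb (a * b) * x"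
  by (simp add: emb_mult mult.assoc)

lemma emb_inverse_cancel: "c \<noteq> 0 \<Longrightarrow> emb (inverse c) * (emb c * x) = x"
  by (simp add: emb_emb emb_one)

end

locale hecke_algebra = central_scalars emb + braid_relations T N
  for emb :: "'k::field \<Rightarrow> 'a::{ring, monoid_mult}" and T :: "nat \<Rightarrow> 'a" and N :: nat +
  fixes s :: 'k
  assumes s_nonzero: "s \<noteq> 0"
    and quadratic: "1 \<le> i \<Longrightarrow> i < N \<Longrightarrow> (T i + emb s) * (T i - emb (inverse s)) = 0"
begin

text \<open>This is the inverse of \<open>T i\<close>, obtained by solving the quadratic
  relation.\<close>

definition Ti :: "nat \<Rightarrow> 'a" where
  "Ti i = T i + emb (s - inverse s)"

lemma T_square:
  assumes "1 \<le> i" "i < N"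
  shows "T i * T i = 1 - emb (s - inverse s) * T i"
proof -
  have one: "emb s * emb (inverse s) = 1"
    using s_nonzero emb_mult[of s "inverse s"] by (simp add: emb_one)
  have "(T i + emb s) * (T i - emb (inverse s)) =
      T i * T i + emb (s - inverse s) * T i - emb s * emb (inverse s)"
    using emb_central[of "inverse s" "T i"]
    by (simp add: distrib_right right_diff_distrib emb_diff left_diff_distrib)
  then show ?thesis
    using quadratic[OF assms] one by (simp add: algebra_simps)
qed

lemma T_Ti: "1 \<le> i \<Longrightarrow> i < N \<Longrightarrow> T i * Ti i = 1"
  by (simp add: Ti_def distrib_left T_square emb_central)

lemma Ti_T: "1 \<le> i \<Longrightarrow> i < N \<Longrightarrow> Ti i * T i = 1"
  by (simp add: Ti_def distrib_right T_square)

lemma Ti_square: "1 \<le> i \<Longrightarrow> i < N \<Longrightarrow> Ti i * Ti i = 1 + emb (s - inverse s) * Ti i"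
  by (subst (1) Ti_def) (simp add: distrib_right T_Ti)

lemma commutes_Ti: "x * T i = T i * x \<Longrightarrow> x * Ti i = Ti i * x"
  by (simp add: Ti_def algebra_simps emb_central)

sublocale Ti: braid_relations Ti N
proof
  fix i assume i: "1 \<le> i" "Suc i < N"
  note inv = T_Ti[of i] T_Ti[of "Suc i"] Ti_T[of i] Ti_T[of "Suc i"]
  show "Ti i * (Ti (Suc i) * Ti i) = Ti (Suc i) * (Ti i * Ti (Suc i))"
  \<comment> \<open>Both sides are inverse to the same element, the braid product of the
    \<open>T i\<close>.\<close>
  proof (rule left_right_inverse_unique)
    show "Ti i * (Ti (Suc i) * Ti i) * (T i * (T (Suc i) * T i)) = 1"
      using i by (simp add: mult.assoc inv inv[THEN mult_eq_extend])
    show "T i * (T (Suc i) * T i) * (Ti (Suc i) * (Ti i * Ti (Suc i))) = 1"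
      using i by (simp add: braid mult.assoc inv inv[THEN mult_eq_extend])
  qed
next
  fix i j assume ij: "1 \<le> i" "Suc i < j" "j < N"
  show "Ti i * Ti j = Ti j * Ti i"
    using commutes_Ti[OF commutes_Ti[OF far_comm[OF ij], symmetric]] by simp
qed

section \<open>The symmetrizer\<close>

definition Tw :: "(nat \<Rightarrow> nat) \<Rightarrow> 'a" where
  "Tw w = word_prod (some_reduced_word N w)"

text \<open>With \<open>s\<close> the square root of t, this is e_N; the first factor inverts the
  Poincare polynomial of the symmetric group at 1/t.\<close>

definition symmetrizer :: 'a where
  "symmetrizer = emb (inverse (\<Sum>w | w permutes {1..N}. inverse (s\<^sup>2) ^ perm_length N w)) *
     (\<Sum>w | w permutes {1..N}. emb (inverse s ^ perm_length N w) * Tw w)"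

text \<open>By Matsumoto's theorem the reduced word chosen in \<open>Tw\<close> may be replaced by
  any other.\<close>

lemma Tw_eq_word_prod:
  assumes "w permutes {1..N}" "set ks \<subseteq> {1..<N}" "simple_perm ks = w" "length ks = perm_length N w"
  shows "Tw w = word_prod ks"
  unfolding Tw_def
  by (rule matsumoto[OF some_reduced_word])
    (use assms reduced_word_iff perm_length_eq_card_inversions in auto)

lemma T_Tw:
  assumes w: "w permutes {1..N}" and i: "i \<in> {1..<N}"
    and l: "perm_length N (Transposition.transpose i (Suc i) \<circ> w) = Suc (perm_length N w)"
  shows "T i * Tw w = Tw (Transposition.transpose i (Suc i) \<circ> w)"
proof -
  have r: "set (some_reduced_word N w) \<subseteq> {1..<N}" "simple_perm (some_reduced_word N w) = w"
    using some_reduced_word[OF w] by (auto simp: reduced_word_def)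
  have "Tw (Transposition.transpose i (Suc i) \<circ> w) = word_prod (i # some_reduced_word N w)"
    by (rule Tw_eq_word_prod)
      (use r i l permutes_compose[OF w simple_transposition_permutes[OF i]] in
        \<open>auto simp: simple_perm_simps perm_length_def\<close>)
  then show ?thesis
    by (simp add: Tw_def)
qed

lemma Tw_T:
  assumes w: "w permutes {1..N}" and i: "i \<in> {1..<N}"
    and l: "perm_length N (w \<circ> Transposition.transpose i (Suc i)) = Suc (perm_length N w)"
  shows "Tw w * T i = Tw (w \<circ> Transposition.transpose i (Suc i))"
proof -
  have r: "set (some_reduced_word N w) \<subseteq> {1..<N}" "simple_perm (some_reduced_word N w) = w"
    using some_reduced_word[OF w] by (auto simp: reduced_word_def)
  have "Tw (w \<circ> Transposition.transpose i (Suc i)) = word_prod (some_reduced_word N w @ [i])"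
    by (rule Tw_eq_word_prod)
      (use r i l permutes_compose[OF simple_transposition_permutes[OF i] w] in
        \<open>auto simp: simple_perm_append simple_perm_simps perm_length_def\<close>)
  then show ?thesis
    by (simp add: Tw_def)
qed

text \<open>The summands are paired by left multiplication with the transposition.
  \<open>T i\<close> maps the shorter element of a pair to the longer one, and acts on the longer
  one by the quadratic relation; the weights make the weighted sum of each pair an
  eigenvector.\<close>

lemma T_symmetrizer:
  assumes i: "i \<in> {1..<N}"
  shows "T i * symmetrizer = emb (inverse s) * symmetrizer"
proof -
  define \<phi> where "\<phi> w = Transposition.transpose i (Suc i) \<circ> w" for w :: "nat \<Rightarrow> nat"
  let ?W = "{w. w permutes {1..N}}"
  let ?P = "\<lambda>w. perm_length N (\<phi> w) = Suc (perm_length N w)"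
  let ?f = "\<lambda>w. emb (inverse s ^ perm_length N w) * Tw w"
  have sum: "sum ?f ?W = (\<Sum>w | w \<in> ?W \<and> ?P w. ?f w + ?f (\<phi> w))"
  proof (rule sum_involution)
    fix w assume "w \<in> ?W"
    then have w: "w permutes {1..N}" by simp
    show "\<phi> w \<in> ?W"
      using permutes_compose[OF w simple_transposition_permutes[OF i]] by (simp add: \<phi>_def)
    show c: "\<phi> (\<phi> w) = w"
      unfolding \<phi>_def by (rule transpose_comp_cancel)
    show "?P (\<phi> w) \<longleftrightarrow> \<not> ?P w"
      unfolding c using perm_length_transpose_left[OF w i] unfolding \<phi>_def by linarith
  qed (simp add: finite_permutations)
  have "T i * (?f w + ?f (\<phi> w)) = emb (inverse s) * (?f w + ?f (\<phi> w))" if "w \<in> ?W" "?P w" for w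
  proof -
    let ?l = "perm_length N w" and ?x = "Tw w" and ?y = "Tw (\<phi> w)"
    have Tx: "T i * ?x = ?y"
      using T_Tw[OF _ i] that unfolding \<phi>_def by simp
    have Ty: "T i * ?y = ?x - emb (s - inverse s) * ?y"
    proof -
      have "T i * ?y = T i * T i * ?x"
        by (simp only: Tx mult.assoc)
      also have "\<dots> = ?x - emb (s - inverse s) * ?y"
        using T_square[of i] i by (simp add: left_diff_distrib mult.assoc Tx)
      finally show ?thesis .
    qed
    have "T i * (?f w + ?f (\<phi> w)) =
        emb (inverse s ^ Suc ?l) * ?x + emb (inverse s ^ ?l - inverse s ^ Suc ?l * (s - inverse s)) * ?y"
      unfolding that(2)
      by (simp add: distrib_left emb_left[of "T i"] Tx Ty right_diff_distrib emb_emb emb_diff left_diff_distrib)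
    \<comment> \<open>The left-hand side is \<open>s^(-l) - s^(-l) + s^(-l-2)\<close>, where the
      first two terms cancel.\<close>
    also have "inverse s ^ ?l - inverse s ^ Suc ?l * (s - inverse s) = inverse s * inverse s ^ Suc ?l"
      using s_nonzero by (simp add: field_simps)
    finally show ?thesis
      unfolding that(2) by (simp add: distrib_left emb_emb)
  qed
  then have "T i * sum ?f ?W = emb (inverse s) * sum ?f ?W"
    unfolding sum sum_distrib_left by (intro sum.cong) auto
  then show ?thesis
    unfolding symmetrizer_def by (simp add: emb_left[of "T i"] emb_emb mult.commute)
qed

lemma symmetrizer_T:
  assumes i: "i \<in> {1..<N}"
  shows "symmetrizer * T i = emb (inverse s) * symmetrizer"
proof -
  define \<phi> where "\<phi> w = w \<circ> Transposition.transpose i (Suc i)" for w :: "nat \<Rightarrow> nat"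
  let ?W = "{w. w permutes {1..N}}"
  let ?P = "\<lambda>w. perm_length N (\<phi> w) = Suc (perm_length N w)"
  let ?f = "\<lambda>w. emb (inverse s ^ perm_length N w) * Tw w"
  have sum: "sum ?f ?W = (\<Sum>w | w \<in> ?W \<and> ?P w. ?f w + ?f (\<phi> w))"
  proof (rule sum_involution)
    fix w assume "w \<in> ?W"
    then have w: "w permutes {1..N}" by simp
    show "\<phi> w \<in> ?W"
      using permutes_compose[OF simple_transposition_permutes[OF i] w] by (simp add: \<phi>_def)
    show c: "\<phi> (\<phi> w) = w"
      by (simp add: \<phi>_def fun_eq_iff)
    show "?P (\<phi> w) \<longleftrightarrow> \<not> ?P w"
      unfolding c using perm_length_transpose_right[OF w i] unfolding \<phi>_def by linarith
  qed (simp add: finite_permutations)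
  have "(?f w + ?f (\<phi> w)) * T i = emb (inverse s) * (?f w + ?f (\<phi> w))" if "w \<in> ?W" "?P w" for w
  proof -
    let ?l = "perm_length N w" and ?x = "Tw w" and ?y = "Tw (\<phi> w)"
    have Tx: "?x * T i = ?y"
      using Tw_T[OF _ i] that unfolding \<phi>_def by simp
    have Ty: "?y * T i = ?x - emb (s - inverse s) * ?y"
    proof -
      have "?y * T i = ?x * (T i * T i)"
        by (simp only: Tx flip: mult.assoc)
      also have "\<dots> = ?x - emb (s - inverse s) * ?y"
        using T_square[of i] i by (simp add: right_diff_distrib emb_left Tx)
      finally show ?thesis .
    qed
    have "(?f w + ?f (\<phi> w)) * T i =
        emb (inverse s ^ Suc ?l) * ?x + emb (inverse s ^ ?l - inverse s ^ Suc ?l * (s - inverse s)) * ?y"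
      unfolding that(2)
      by (simp add: distrib_right mult.assoc Tx Ty right_diff_distrib emb_emb emb_diff left_diff_distrib)
    also have "inverse s ^ ?l - inverse s ^ Suc ?l * (s - inverse s) = inverse s * inverse s ^ Suc ?l"
      using s_nonzero by (simp add: field_simps)
    finally show ?thesis
      unfolding that(2) by (simp add: distrib_left emb_emb)
  qed
  then have "sum ?f ?W * T i = emb (inverse s) * sum ?f ?W"
    unfolding sum sum_distrib_left sum_distrib_right by (intro sum.cong) auto
  then show ?thesis
    unfolding symmetrizer_def by (simp add: mult.assoc emb_emb mult.commute)
qed

text \<open>\<open>Ti i\<close> and \<open>T i\<close> differ by the scalar
  \<open>s - inverse s\<close>, so the differences of the two sides of both equations agree.\<close>

lemma Ti_eigen_iff:
  assumes "1 \<le> i" "i < N"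
  shows "Ti i * z = emb s * z \<longleftrightarrow> T i * z = emb (inverse s) * z"
proof -
  have "Ti i * z - emb s * z = T i * z - emb (inverse s) * z"
    by (simp add: Ti_def emb_diff algebra_simps)
  then show ?thesis
    by (metis eq_iff_diff_eq_0)
qed

lemma symmetrizer_Ti:
  assumes "1 \<le> i" "i < N"
  shows "symmetrizer * Ti i = emb s * symmetrizer"
  using symmetrizer_T[of i] assms by (simp add: Ti_def distrib_left distrib_right emb_diff
      right_diff_distrib left_diff_distrib flip: emb_central)

text \<open>Each \<open>Tw w\<close> acts on \<open>z\<close> by \<open>inverse s\<close> to the
  power of the length, so the sum without its normalisation multiplies \<open>z\<close> by the value
  of the Poincare polynomial, which cancels by \<open>nz\<close>.\<close>

lemma symmetrizer_fixes:
  assumes nz: "(\<Sum>w | w permutes {1..N}. inverse (s\<^sup>2) ^ perm_length N w) \<noteq> 0"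
    and z: "\<And>i. 1 \<le> i \<Longrightarrow> i < N \<Longrightarrow> Ti i * z = emb s * z"
  shows "symmetrizer * z = z"
proof -
  have Tz: "T i * z = emb (inverse s) * z" if "Suc 0 \<le> i" "i < N" for i
    using z[of i] Ti_eigen_iff[of i z] that by simp
  have word: "word_prod ks * z = emb (inverse s ^ length ks) * z" if "set ks \<subseteq> {1..<N}" for ks
    using that
    by (induction ks)
      (auto simp: emb_one mult.assoc emb_left[of "T _"] Tz emb_emb mult.commute[of "inverse s"])
  have "emb (inverse s ^ perm_length N w) * Tw w * z = emb (inverse (s\<^sup>2) ^ perm_length N w) * z"
    if "w permutes {1..N}" for w
  proof -
    have "Tw w * z = emb (inverse s ^ perm_length N w) * z"
      unfolding Tw_def perm_length_def
      by (rule word) (use some_reduced_word[OF that] in \<open>simp add: reduced_word_def\<close>)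
    then show ?thesis
      by (simp add: mult.assoc emb_emb power2_eq_square power_mult_distrib)
  qed
  then have "(\<Sum>w | w permutes {1..N}. emb (inverse s ^ perm_length N w) * Tw w) * z =
      emb (\<Sum>w | w permutes {1..N}. inverse (s\<^sup>2) ^ perm_length N w) * z"
    unfolding sum_distrib_right emb_sum by (intro sum.cong) auto
  then show ?thesis
    unfolding symmetrizer_def mult.assoc by (simp only: emb_inverse_cancel[OF nz])
qed

end

section \<open>The action of a full loop on partially symmetric elements\<close>

context hecke_algebra
begin

section \<open>The loop element and its commutation relations\<close>

primrec asc :: "nat \<Rightarrow> 'a" where
  "asc 0 = 1"
| "asc (Suc k) = asc k * Ti (Suc k)"

primrec desc :: "nat \<Rightarrow> 'a" where
  "desc 0 = 1"
| "desc (Suc k) = Ti (Suc k) * desc k"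

text \<open>For \<open>k = N - 1\<close> this is the element \<open>J\<close> of the outline; as a
  braid, one strand runs around \<open>k\<close> others.\<close>

definition loop :: "nat \<Rightarrow> 'a" where
  "loop k = asc k * desc k"

lemma commutes_asc: "(\<And>j. 1 \<le> j \<Longrightarrow> j \<le> k \<Longrightarrow> x * Ti j = Ti j * x) \<Longrightarrow> x * asc k = asc k * x"
proof (induction k)
  case (Suc k)
  then have "x * asc k = asc k * x" by simp
  then show ?case
    using mult_eq_extend[of x "asc k" "asc k * x" "Ti (Suc k)"] Suc.prems[of "Suc k"]
    by (simp add: mult.assoc)
qed simp

lemma commutes_desc: "(\<And>j. 1 \<le> j \<Longrightarrow> j \<le> k \<Longrightarrow> x * Ti j = Ti j * x) \<Longrightarrow> x * desc k = desc k * x"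
proof (induction k)
  case (Suc k)
  then have "x * desc k = desc k * x" by simp
  then show ?case
    using mult_eq_extend[OF Suc.prems[of "Suc k"], of "desc k"] by (simp add: mult.assoc)
qed simp

lemma Ti_asc_far: "Suc k < i \<Longrightarrow> i < N \<Longrightarrow> Ti i * asc k = asc k * Ti i"
  by (rule commutes_asc) (rule Ti.far_comm[symmetric]; simp)

lemma Ti_desc_far: "Suc k < i \<Longrightarrow> i < N \<Longrightarrow> Ti i * desc k = desc k * Ti i"
  by (rule commutes_desc) (rule Ti.far_comm[symmetric]; simp)

text \<open>The generator commutes with the factors of the ascending product until it meets
  \<open>Ti (i - 1) * Ti i\<close>, where the braid relation lowers its index; it then commutes with
  the remaining factors.\<close>

lemma Ti_asc_shift:
  assumes "2 \<le> i" "i \<le> k" "k < N"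
  shows "Ti i * asc k = asc k * Ti (i - 1)"
  using assms
proof (induction k)
  case (Suc k)
  show ?case
  proof (cases "i = Suc k")
    case True
    then obtain j where j: "k = Suc j" "i = Suc (Suc j)"
      using Suc.prems by (cases k) auto
    have "Ti i * asc (Suc k) = asc j * (Ti (Suc (Suc j)) * (Ti (Suc j) * Ti (Suc (Suc j))))"
      using mult_eq_extend[OF Ti_asc_far[of j i]] Suc.prems j by (simp add: mult.assoc)
    also have "\<dots> = asc j * (Ti (Suc j) * (Ti (Suc (Suc j)) * Ti (Suc j)))"
      using Ti.braid[of "Suc j"] Suc.prems j by simp
    finally show ?thesis
      using j by (simp add: mult.assoc)
  next
    case False
    then have 1: "Ti i * asc k = asc k * Ti (i - 1)"
      and 2: "Ti (i - 1) * Ti (Suc k) = Ti (Suc k) * Ti (i - 1)"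
      using Suc Ti.far_comm[of "i - 1" "Suc k"] by auto
    show ?thesis
      using mult_eq_extend[OF 1, of "Ti (Suc k)"] 2 by (simp add: mult.assoc)
  qed
qed simp

lemma Ti_desc_shift:
  assumes "2 \<le> i" "i \<le> k" "k < N"
  shows "Ti (i - 1) * desc k = desc k * Ti i"
  using assms
proof (induction k)
  case (Suc k)
  show ?case
  proof (cases "i = Suc k")
    case True
    then obtain j where j: "k = Suc j" "i = Suc (Suc j)"
      using Suc.prems by (cases k) auto
    have "Ti (i - 1) * desc (Suc k) = Ti (Suc j) * (Ti (Suc (Suc j)) * Ti (Suc j)) * desc j"
      using j by (simp add: mult.assoc)
    also have "\<dots> = Ti (Suc (Suc j)) * (Ti (Suc j) * Ti (Suc (Suc j))) * desc j"
      using Ti.braid[of "Suc j"] Suc.prems j by simp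
    finally show ?thesis
      using Ti_desc_far[of j i] Suc.prems j by (simp add: mult.assoc)
  next
    case False
    then have 1: "Ti (i - 1) * desc k = desc k * Ti i"
      and 2: "Ti (i - 1) * Ti (Suc k) = Ti (Suc k) * Ti (i - 1)"
      using Suc Ti.far_comm[of "i - 1" "Suc k"] by auto
    show ?thesis
      using mult_eq_extend[OF 2, of "desc k"] 1 by (simp add: mult.assoc)
  qed
qed simp

text \<open>Passing the ascending half lowers the index by one, and passing the descending half
  raises it again.\<close>

lemma Ti_loop:
  assumes "2 \<le> i" "i \<le> k" "k < N"
  shows "Ti i * loop k = loop k * Ti i"
  using mult_eq_extend[OF Ti_asc_shift[OF assms], of "desc k"] Ti_desc_shift[OF assms]
  by (simp add: loop_def mult.assoc)

text \<open>Braiding the three innermost factors brings \<open>Ti (Suc (Suc k))\<close> to the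
  outside, past all factors of index at most \<open>k\<close>. The middle product for
  \<open>Suc k\<close> is thus expressed by that for \<open>k\<close>.\<close>

lemma asc_Ti_desc_Suc:
  assumes "Suc (Suc k) < N"
  shows "asc (Suc k) * (Ti (Suc (Suc k)) * desc (Suc k)) =
    Ti (Suc (Suc k)) * (asc k * (Ti (Suc k) * (desc k * Ti (Suc (Suc k)))))"
proof -
  have "asc (Suc k) * (Ti (Suc (Suc k)) * desc (Suc k)) =
      asc k * (Ti (Suc k) * (Ti (Suc (Suc k)) * Ti (Suc k)) * desc k)"
    by (simp add: mult.assoc)
  also have "\<dots> = asc k * (Ti (Suc (Suc k)) * (Ti (Suc k) * Ti (Suc (Suc k))) * desc k)"
    using Ti.braid[of "Suc k"] assms by simp
  finally show ?thesis
    using mult_eq_extend[OF Ti_asc_far[of k "Suc (Suc k)"]] Ti_desc_far[of k "Suc (Suc k)"] assms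
    by (simp add: mult.assoc)
qed

text \<open>The two innermost factors form a square; the quadratic relation replaces it by the
  shorter loop and a term with a single innermost factor.\<close>

lemma loop_Suc:
  assumes "Suc k < N"
  shows "loop (Suc k) = loop k + emb (s - inverse s) * (asc k * (Ti (Suc k) * desc k))"
proof -
  have "loop (Suc k) = asc k * ((Ti (Suc k) * Ti (Suc k)) * desc k)"
    by (simp add: loop_def mult.assoc)
  also have "\<dots> = asc k * (1 + emb (s - inverse s) * Ti (Suc k)) * desc k"
    using Ti_square[of "Suc k"] assms by (simp add: mult.assoc)
  finally show ?thesis
    by (simp add: loop_def distrib_left distrib_right mult.assoc emb_left[of "asc k"])
qed

section \<open>Action on an element \<open>u\<close> symmetric under all generators but the
  first\<close>

context
  fixes u :: 'a
  assumes u: "\<And>i. 2 \<le> i \<Longrightarrow> i < N \<Longrightarrow> Ti i * u = emb s * u"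
begin

text \<open>The vector for \<open>Suc k\<close> is \<open>emb s * Ti (Suc (Suc k))\<close> applied
  to the vector for \<open>k\<close>, and for \<open>k \<ge> 1\<close> this generator commutes with
  \<open>Ti 1\<close>. The base case is the braid relation of \<open>Ti 1\<close> and
  \<open>Ti 2\<close>.\<close>

lemma Ti_1_asc_Ti_desc:
  assumes "1 \<le> k" "Suc k < N"
  shows "Ti 1 * (asc k * (Ti (Suc k) * (desc k * u))) = emb s * (asc k * (Ti (Suc k) * (desc k * u)))"
  using assms
proof (induction k rule: nat_induct_at_least)
  case base
  have N: "2 < N" using base by simp
  have u2: "Ti 2 * u = emb s * u" using u[of 2] N by simp
  have b: "Ti 1 * (Ti 2 * Ti 1) = Ti 2 * (Ti 1 * Ti 2)"
    using Ti.braid[of 1] N by (simp add: numeral_2_eq_2)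
  have "asc 1 * (Ti (Suc 1) * (desc 1 * u)) = Ti 1 * (Ti 2 * Ti 1) * u"
    by (simp add: mult.assoc numeral_2_eq_2)
  also have "\<dots> = Ti 2 * (Ti 1 * (Ti 2 * u))"
    unfolding b by (simp add: mult.assoc)
  also have "\<dots> = emb s * (Ti 2 * (Ti 1 * u))"
    unfolding u2 by (simp add: emb_left[of "Ti _"])
  finally have eq: "asc 1 * (Ti (Suc 1) * (desc 1 * u)) = emb s * (Ti 2 * (Ti 1 * u))" .
  have "Ti 1 * (Ti 2 * (Ti 1 * u)) = Ti 2 * (Ti 1 * (Ti 2 * u))"
    using mult_eq_extend2[OF b, of u] by (simp add: mult.assoc)
  also have "\<dots> = emb s * (Ti 2 * (Ti 1 * u))"
    unfolding u2 by (simp add: emb_left[of "Ti _"])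
  finally show ?case
    unfolding eq by (simp add: emb_left[of "Ti 1"] del: One_nat_def)
next
  case (Suc k)
  let ?a = "Ti (Suc (Suc k))" and ?R = "asc k * (Ti (Suc k) * (desc k * u))"
  have "asc (Suc k) * (?a * (desc (Suc k) * u)) = (asc (Suc k) * (?a * desc (Suc k))) * u"
    by (simp add: mult.assoc)
  also have "\<dots> = ?a * (asc k * (Ti (Suc k) * (desc k * (?a * u))))"
    unfolding asc_Ti_desc_Suc[OF Suc.prems] by (simp add: mult.assoc)
  also have "\<dots> = emb s * (?a * ?R)"
    using u[of "Suc (Suc k)"] Suc.prems
    by (simp add: emb_left[of "Ti _"] emb_left[of "asc k"] emb_left[of "desc k"])
  finally have eq: "asc (Suc k) * (?a * (desc (Suc k) * u)) = emb s * (?a * ?R)" .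
  have "Ti 1 * (?a * ?R) = ?a * (Ti 1 * ?R)"
    using mult_eq_extend[OF Ti.far_comm[of 1 "Suc (Suc k)"]] Suc by (simp add: mult.assoc)
  also have "\<dots> = emb s * (?a * ?R)"
    using Suc by (simp add: emb_left[of "Ti _"])
  finally show ?case
    unfolding eq by (simp add: emb_left[of "Ti 1"] del: One_nat_def)
qed

text \<open>By \<open>loop_Suc\<close> the vectors for consecutive \<open>k\<close> differ by a
  multiple of the eigenvector found in \<open>Ti_1_asc_Ti_desc\<close>. The case
  \<open>k = 1\<close> is a computation with the quadratic relation.\<close>

lemma Ti_1_loop:
  assumes "1 \<le> k" "k < N"
  shows "Ti 1 * (u - emb (s\<^sup>2) * (loop k * u)) = emb s * (u - emb (s\<^sup>2) * (loop k * u))"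
  using assms
proof (induction k rule: nat_induct_at_least)
  case base
  define d where "d = s - inverse s"
  have sq: "Ti 1 * (Ti 1 * x) = x + emb d * (Ti 1 * x)" for x
    using mult_eq_extend[OF Ti_square[of 1], of x] base by (simp add: d_def distrib_right mult.assoc)
  have loop: "loop 1 * u = u + emb d * (Ti 1 * u)"
    using sq[of u] by (simp add: loop_def mult.assoc)
  have 1: "Ti 1 * (u - emb (s\<^sup>2) * (loop 1 * u)) =
      emb (1 - s\<^sup>2 - s\<^sup>2 * d * d) * (Ti 1 * u) - emb (s\<^sup>2 * d) * u"
    unfolding loop by (simp add: right_diff_distrib distrib_left emb_left[of "Ti 1"] sq emb_emb
        emb_diff emb_one left_diff_distrib mult.assoc del: One_nat_def)
  have 2: "emb s * (u - emb (s\<^sup>2) * (loop 1 * u)) =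
      emb (s - s * s\<^sup>2) * u - emb (s * s\<^sup>2 * d) * (Ti 1 * u)"
    unfolding loop by (simp add: right_diff_distrib distrib_left emb_emb
        emb_diff left_diff_distrib mult.assoc)
  \<comment> \<open>Comparison of the coefficients of \<open>u\<close> and of
    \<open>Ti 1 * u\<close>, where \<open>s\<^sup>2 * d = s ^ 3 - s\<close>.\<close>
  have 3: "- (s\<^sup>2 * d) = s - s * s\<^sup>2" "1 - s\<^sup>2 - s\<^sup>2 * d * d = - (s * s\<^sup>2 * d)"
    using s_nonzero by (simp_all add: d_def field_simps power2_eq_square)
  have minus: "emb (- c) = - emb c" for c
    using emb_diff[of 0 c] by (simp add: emb_zero)
  show ?case
    unfolding 1 2 3(2) 3(1)[symmetric] minus by simp
next
  case (Suc k)
  let ?R = "asc k * (Ti (Suc k) * (desc k * u))"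
  let ?v = "u - emb (s\<^sup>2) * (loop k * u)"
  have eq: "u - emb (s\<^sup>2) * (loop (Suc k) * u) = ?v - emb (s\<^sup>2 * (s - inverse s)) * ?R"
    using Suc.prems by (simp add: loop_Suc distrib_left distrib_right mult.assoc emb_emb algebra_simps)
  have v: "Ti 1 * ?v = emb s * ?v"
    using Suc by simp
  have R: "Ti 1 * ?R = emb s * ?R"
    using Suc by (intro Ti_1_asc_Ti_desc) simp_all
  show ?case
    unfolding eq right_diff_distrib[of _ ?v] v emb_left[of "Ti 1"] R emb_left[of "emb s"] ..
qed

text \<open>The left-hand side is an eigenvector of every \<open>Ti i\<close>: by
  \<open>Ti_1_loop\<close> for \<open>i = 1\<close>, and because the loop commutes with
  \<open>Ti i\<close> for \<open>i \<ge> 2\<close>. Hence the symmetrizer fixes it. As the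
  symmetrizer absorbs each of the \<open>2 * (N - 1)\<close> factors of the loop as a scalar
  \<open>s\<close>, the coefficient of the loop term becomes \<open>(s\<^sup>2) ^ N\<close>.\<close>

lemma symmetrizer_of_partially_symmetric:
  assumes nz: "(\<Sum>w | w permutes {1..N}. inverse (s\<^sup>2) ^ perm_length N w) \<noteq> 0" and N: "1 \<le> N"
  shows "u - emb (s\<^sup>2) * (loop (N - 1) * u) = emb (1 - (s\<^sup>2) ^ N) * (symmetrizer * u)"
proof -
  let ?z = "u - emb (s\<^sup>2) * (loop (N - 1) * u)"
  have "Ti i * ?z = emb s * ?z" if "1 \<le> i" "i < N" for i
  proof (cases "i = 1")
    case True
    then show ?thesis
      using Ti_1_loop[of "N - 1"] that by simp
  next
    case False
    then have "Ti i * (loop (N - 1) * u) = loop (N - 1) * (Ti i * u)"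
      using mult_eq_extend[OF Ti_loop[of i "N - 1"]] that by (simp add: mult.assoc)
    then show ?thesis
      using u[of i] that False
      by (simp add: right_diff_distrib emb_left[of "Ti _"] emb_left[of "loop _"] emb_emb mult.commute)
  qed
  then have z: "symmetrizer * ?z = ?z"
    by (rule symmetrizer_fixes[OF nz])
  have asc: "symmetrizer * asc k = emb (s ^ k) * symmetrizer" if "k < N" for k
    using that
  proof (induction k)
    case (Suc k)
    have "symmetrizer * asc (Suc k) = symmetrizer * asc k * Ti (Suc k)"
      by (simp add: mult.assoc)
    also have "\<dots> = emb (s ^ k) * (emb s * symmetrizer)"
      using Suc symmetrizer_Ti[of "Suc k"] by (simp add: mult.assoc)
    finally show ?case
      by (simp add: emb_emb mult.commute)
  qed (simp add: emb_one)
  have desc: "symmetrizer * desc k = emb (s ^ k) * symmetrizer" if "k < N" for k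
    using that
  proof (induction k)
    case (Suc k)
    have "symmetrizer * desc (Suc k) = symmetrizer * Ti (Suc k) * desc k"
      by (simp add: mult.assoc)
    also have "\<dots> = emb s * (emb (s ^ k) * symmetrizer)"
      using Suc symmetrizer_Ti[of "Suc k"] by (simp add: mult.assoc)
    finally show ?case
      by (simp add: emb_emb)
  qed (simp add: emb_one)
  have loop: "symmetrizer * loop (N - 1) = emb (s ^ (N - 1) * s ^ (N - 1)) * symmetrizer"
    using mult_eq_extend[OF asc[of "N - 1"], of "desc (N - 1)"] desc[of "N - 1"] N
    by (simp add: loop_def mult.assoc emb_emb)
  have "s\<^sup>2 * (s ^ (N - 1) * s ^ (N - 1)) = (s\<^sup>2) ^ N"
    using N by (cases N) (simp_all add: power2_eq_square power_mult_distrib)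
  then show ?thesis
    by (subst z[symmetric]) (simp add: right_diff_distrib emb_left[of symmetrizer] mult_eq_extend[OF loop]
        mult.assoc emb_emb emb_diff emb_one left_diff_distrib del: One_nat_def)
qed

end

end

section \<open>The double affine Hecke algebra\<close>

locale daha = hecke_algebra emb T N s
  for emb :: "'k::field \<Rightarrow> 'a::{ring, monoid_mult}" and T :: "nat \<Rightarrow> 'a" and N :: nat and s :: 'k +
  fixes q :: 'k and X Xi Y Yi :: "nat \<Rightarrow> 'a"
  assumes N_pos: "1 \<le> N"
    and X_inverse: "i \<in> {1..N} \<Longrightarrow> X i * Xi i = 1" "i \<in> {1..N} \<Longrightarrow> Xi i * X i = 1"
    and Y_inverse: "i \<in> {1..N} \<Longrightarrow> Y i * Yi i = 1" "i \<in> {1..N} \<Longrightarrow> Yi i * Y i = 1"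
    and X_comm: "i \<in> {1..N} \<Longrightarrow> k \<in> {1..N} \<Longrightarrow> X i * X k = X k * X i"
    and TXT: "i \<in> {1..<N} \<Longrightarrow> T i * X i * T i = X (i + 1)"
    and TYT: "i \<in> {1..<N} \<Longrightarrow> Ti i * Y i * Ti i = Y (i + 1)"
    and TX_comm: "i \<in> {1..<N} \<Longrightarrow> k \<in> {1..N} \<Longrightarrow> \<bar>int i - int k\<bar> > 1 \<Longrightarrow> T i * X k = X k * T i"
    and TY_comm: "i \<in> {1..<N} \<Longrightarrow> k \<in> {1..N} \<Longrightarrow> \<bar>int i - int k\<bar> > 1 \<Longrightarrow> T i * Y k = Y k * T i"
    and Y1_X: "Y 1 * prod_list (map X [1..<N + 1]) = emb q * prod_list (map X [1..<N + 1]) * Y 1"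
    and X1i_Y2: "2 \<le> N \<Longrightarrow> Xi 1 * Y 2 = Y 2 * Xi 1 * Ti 1 ^ 2"
begin

section \<open>Commutation of the generators with \<open>X 1\<close> and \<open>Y 1\<close>\<close>

lemma Ti_X_comm: "i \<in> {1..<N} \<Longrightarrow> k \<in> {1..N} \<Longrightarrow> \<bar>int i - int k\<bar> > 1 \<Longrightarrow> X k * Ti i = Ti i * X k"
  using TX_comm commutes_Ti by simp

lemma Ti_Y_comm: "i \<in> {1..<N} \<Longrightarrow> k \<in> {1..N} \<Longrightarrow> \<bar>int i - int k\<bar> > 1 \<Longrightarrow> Y k * Ti i = Ti i * Y k"
  using TY_comm commutes_Ti by simp

text \<open>For \<open>i = 2\<close> this is not among the defining relations; it follows from
  \<open>T\<^sub>1 X\<^sub>3 = X\<^sub>3 T\<^sub>1\<close>, where \<open>X\<^sub>3 = T\<^sub>2 T\<^sub>1 X\<^sub>1 T\<^sub>1 T\<^sub>2\<close>.\<close>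

lemma T_X1:
  assumes "2 \<le> i" "i < N"
  shows "T i * X 1 = X 1 * T i"
proof (cases "i = 2")
  case True
  then have N: "2 < N" using assms by simp
  have X3: "X 3 = T 2 * (T 1 * (X 1 * (T 1 * T 2)))"
  proof -
    have "X 2 = T 1 * (X 1 * T 1)" "X 3 = T 2 * (X 2 * T 2)"
      using TXT[of 1] TXT[of 2] N by (simp_all add: mult.assoc numeral_2_eq_2 numeral_3_eq_3)
    then show ?thesis
      by (simp add: mult.assoc)
  qed
  have "T 1 * X 3 = X 3 * T 1"
    using TX_comm[of 1 3] N by simp
  then have "T 2 * X 1 = X 1 * T 2"
    unfolding X3 mult.assoc using N braid[of 1]
    by (intro commutes_of_braid_conjugate[of "Ti 1" "T 1" "Ti 2" "T 2"])
      (simp_all add: T_Ti Ti_T numeral_2_eq_2)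
  then show ?thesis
    using True by simp
next
  case False
  then show ?thesis
    using TX_comm[of i 1] assms by simp
qed

text \<open>As for \<open>X 1\<close>, the case \<open>i = 2\<close> comes from the commutation of
  \<open>Ti 1\<close> with \<open>Y 3\<close>, the inverse generators now taking the place of the
  generators.\<close>

lemma T_Y1:
  assumes "2 \<le> i" "i < N"
  shows "T i * Y 1 = Y 1 * T i"
proof (cases "i = 2")
  case True
  then have N: "2 < N" using assms by simp
  have Y3: "Y 3 = Ti 2 * (Ti 1 * (Y 1 * (Ti 1 * Ti 2)))"
  proof -
    have "Y 2 = Ti 1 * (Y 1 * Ti 1)" "Y 3 = Ti 2 * (Y 2 * Ti 2)"
      using TYT[of 1] TYT[of 2] N by (simp_all add: mult.assoc numeral_2_eq_2 numeral_3_eq_3)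
    then show ?thesis
      by (simp add: mult.assoc)
  qed
  have "Ti 1 * Y 3 = Y 3 * Ti 1"
    using Ti_Y_comm[of 1 3] N by simp
  then have "Ti 2 * Y 1 = Y 1 * Ti 2"
    unfolding Y3 mult.assoc using N Ti.braid[of 1]
    by (intro commutes_of_braid_conjugate[of "T 1" "Ti 1" "T 2" "Ti 2"])
      (simp_all add: T_Ti Ti_T numeral_2_eq_2)
  then have "Y 1 * T 2 = T 2 * Y 1"
    using N by (intro commutes_inverse[of "Y 1" "Ti 2" "T 2"]) (simp_all add: T_Ti Ti_T)
  then show ?thesis
    using True by simp
next
  case False
  then show ?thesis
    using TY_comm[of i 1] assms by simp
qed

section \<open>Moving \<open>Y 1\<close> across the product of the \<open>X i\<close>\<close>

primrec asc_T :: "nat \<Rightarrow> 'a" where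
  "asc_T 0 = 1"
| "asc_T (Suc k) = asc_T k * T (Suc k)"

lemma desc_asc_T: "k < N \<Longrightarrow> desc k * asc_T k = 1"
proof (induction k)
  case (Suc k)
  have "desc (Suc k) * asc_T (Suc k) = Ti (Suc k) * (desc k * asc_T k) * T (Suc k)"
    by (simp add: mult.assoc)
  then show ?case
    using Suc by (simp add: Ti_T)
qed simp

lemma Ti_asc_T: "Suc k < i \<Longrightarrow> i < N \<Longrightarrow> Ti i * asc_T k = asc_T k * Ti i"
proof (induction k)
  case (Suc k)
  have "T (Suc k) * T i = T i * T (Suc k)"
    using far_comm[of "Suc k" i] Suc.prems by simp
  then have 1: "Ti i * T (Suc k) = T (Suc k) * Ti i"
    using commutes_Ti by simp
  have 2: "Ti i * asc_T k = asc_T k * Ti i"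
    using Suc by simp
  show ?case
    using mult_eq_extend[OF 2, of "T (Suc k)"] 1 by (simp add: mult.assoc)
qed simp

lemma Y1_X2:
  assumes "2 \<le> N"
  shows "Y 1 * X 2 = X 2 * (Ti 1 * (Ti 1 * Y 1))"
proof -
  note inv = T_Ti[of 1] Ti_T[of 1] X_inverse[of 1]
  note inv' = inv inv[THEN mult_eq_extend]
  have Y2: "Y 2 = Ti 1 * (Y 1 * Ti 1)"
    using TYT[of 1] assms by (simp add: mult.assoc numeral_2_eq_2)
  have X2: "X 2 = T 1 * (X 1 * T 1)"
    using TXT[of 1] assms by (simp add: mult.assoc numeral_2_eq_2)
  have "Xi 1 * Y 2 = Y 2 * (Xi 1 * (Ti 1 * Ti 1))"
    using X1i_Y2[OF assms] by (simp add: mult.assoc power2_eq_square)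
  \<comment> \<open>The factor on the left cancels \<open>Xi 1\<close> on the left-hand side; the
    factor on the right cancels \<open>Xi 1\<close> and the square of \<open>Ti 1\<close> on the
    right-hand side.\<close>
  then have "T 1 * (X 1 * (Xi 1 * Y 2)) * (T 1 * (T 1 * (X 1 * T 1))) =
      T 1 * (X 1 * (Y 2 * (Xi 1 * (Ti 1 * Ti 1)))) * (T 1 * (T 1 * (X 1 * T 1)))"
    by simp
  then have "Y 1 * (T 1 * (X 1 * T 1)) = T 1 * (X 1 * (Ti 1 * Y 1))"
    unfolding Y2 using assms by (simp add: mult.assoc inv' del: One_nat_def)
  then show ?thesis
    unfolding X2 using assms by (simp add: mult.assoc inv' del: One_nat_def)
qed

text \<open>Induction from \<open>Y1_X2\<close>. The next \<open>X\<close> is the present one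
  multiplied by \<open>T (Suc k)\<close> on both sides, and \<open>T (Suc k)\<close> commutes with
  \<open>Y 1\<close>, so it remains to carry it through the Hecke factor.\<close>

lemma Y1_X_Suc:
  assumes "1 \<le> k" "k < N"
  shows "Y 1 * X (Suc k) = X (Suc k) * (asc_T (k - 1) * (Ti k * (Ti k * (desc (k - 1) * Y 1))))"
  using assms
proof (induction k rule: nat_induct_at_least)
  case base
  then show ?case
    using Y1_X2 by (simp add: numeral_2_eq_2)
next
  case (Suc k)
  then obtain l where k: "k = Suc l"
    by (cases k) auto
  let ?T = "T (Suc k)" and ?a = "Ti k" and ?b = "Ti (Suc k)"
  note inv = T_Ti[of k] Ti_T[of k] T_Ti[of "Suc k"] Ti_T[of "Suc k"]
  note inv' = inv inv[THEN mult_eq_extend]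
  have kN: "1 \<le> k" "k < N" "Suc k < N"
    using Suc by auto
  have br: "?a * (?b * ?a) = ?b * (?a * ?b)"
    using Ti.braid[of k] kN by simp
  \<comment> \<open>Moves the squared inverse generator from index \<open>k\<close> to
    \<open>Suc k\<close>.\<close>
  have "?b * (?a * (?a * ?T)) = T k * (?b * (?b * ?a))"
  proof -
    have "?a * (?b * (?a * (?a * ?T))) = ?b * (?a * (?b * (?a * ?T)))"
      using mult_eq_extend2[OF br] by (simp add: mult.assoc)
    also have "?b * (?a * (?b * (?a * ?T))) = ?b * (?b * (?a * (?b * ?T)))"
      using mult_eq_extend2[OF br] by (simp add: mult.assoc)
    also have "\<dots> = ?b * (?b * ?a)"
      using kN by (simp add: inv')
    finally have "T k * (?a * (?b * (?a * (?a * ?T)))) = T k * (?b * (?b * ?a))"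
      by simp
    then show ?thesis
      using kN by (simp add: inv')
  qed
  then have br2: "?b * (?a * (?a * (?T * z))) = T k * (?b * (?b * (?a * z)))" for z
    by (metis mult.assoc)
  have X: "X (Suc (Suc k)) = ?T * (X (Suc k) * ?T)"
    using TXT[of "Suc k"] kN by (simp add: mult.assoc)
  have TY: "Y 1 * ?T = ?T * Y 1"
    using T_Y1[of "Suc k"] kN by simp
  have Td: "desc l * ?T = ?T * desc l"
    using commutes_inverse[of "desc l" ?b ?T] Ti_desc_far[of l "Suc k"] kN k inv by simp
  have "Y 1 * X (Suc (Suc k)) = ?T * ((Y 1 * X (Suc k)) * ?T)"
    unfolding X using mult_eq_extend[OF TY] by (simp add: mult.assoc)
  also have "Y 1 * X (Suc k) = X (Suc k) * (asc_T l * (?a * (?a * (desc l * Y 1))))"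
    using Suc.IH kN k by simp
  also have "?T * (X (Suc k) * (asc_T l * (?a * (?a * (desc l * Y 1)))) * ?T) =
      ?T * (X (Suc k) * (asc_T l * (?a * (?a * (?T * (desc l * Y 1))))))"
    using TY mult_eq_extend[OF Td] by (simp add: mult.assoc)
  \<comment> \<open>Inserting \<open>?T * ?b = 1\<close> completes the factor
    \<open>X (Suc (Suc k))\<close>.\<close>
  also have "\<dots> = ?T * (X (Suc k) * (?T * (?b * (asc_T l * (?a * (?a * (?T * (desc l * Y 1))))))))"
    using kN by (simp add: inv')
  also have "\<dots> = X (Suc (Suc k)) * (asc_T l * (?b * (?a * (?a * (?T * (desc l * Y 1))))))"
    unfolding X using mult_eq_extend[OF Ti_asc_T[of l "Suc k"]] kN k by (simp add: mult.assoc)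
  also have "\<dots> = X (Suc (Suc k)) * (asc_T k * (?b * (?b * (desc k * Y 1))))"
    unfolding br2 using k by (simp add: mult.assoc)
  finally show ?case
    by simp
qed

text \<open>The new factor \<open>X (Suc (Suc k))\<close> commutes with \<open>loop k\<close>. The
  Hecke factor that it produces starts with \<open>asc_T k\<close>, which cancels the descending
  half of \<open>loop k\<close>; what is left is \<open>loop (Suc k)\<close>.\<close>

lemma Y1_prod_X:
  "k < N \<Longrightarrow> Y 1 * prod_list (map X [2..<k + 2]) = prod_list (map X [2..<k + 2]) * (loop k * Y 1)"
proof (induction k)
  case 0
  then show ?case by (simp add: loop_def)
next
  case (Suc k)
  let ?Z = "prod_list (map X [2..<k + 2])" and ?x = "X (Suc (Suc k))"
  have Z: "prod_list (map X [2..<Suc k + 2]) = ?Z * ?x"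
    by simp
  have far: "?x * Ti j = Ti j * ?x" if "1 \<le> j" "j \<le> k" for j
    using Ti_X_comm[of j "Suc (Suc k)"] that Suc.prems by simp
  have loop_x: "?x * loop k = loop k * ?x"
    using commutes_asc[of k ?x, OF far] mult_eq_extend[OF commutes_asc[of k ?x, OF far]]
      commutes_desc[of k ?x, OF far] by (simp add: loop_def mult.assoc)
  have "Y 1 * (?Z * ?x) = ?Z * (loop k * (Y 1 * ?x))"
    using mult_eq_extend[OF Suc.IH] Suc.prems by (simp add: mult.assoc)
  also have "\<dots> = ?Z * (loop k * (?x * (asc_T k * (Ti (Suc k) * (Ti (Suc k) * (desc k * Y 1))))))"
    using Y1_X_Suc[of "Suc k"] Suc.prems by simp
  also have "\<dots> = ?Z * (?x * (loop k * (asc_T k * (Ti (Suc k) * (Ti (Suc k) * (desc k * Y 1))))))"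
    using mult_eq_extend[OF loop_x] by (simp add: mult.assoc)
  also have "\<dots> = ?Z * (?x * (asc k * (Ti (Suc k) * (Ti (Suc k) * (desc k * Y 1)))))"
    using mult_eq_extend[OF desc_asc_T[of k]] Suc.prems by (simp add: loop_def mult.assoc)
  finally show ?case
    unfolding Z by (simp add: loop_def mult.assoc)
qed

lemma prod_X_left_inverse:
  assumes "set ks \<subseteq> {1..N}"
  shows "\<exists>z. z * prod_list (map X ks) = 1"
  using assms
proof (induction ks)
  case Nil
  show ?case by (intro exI[of _ 1]) simp
next
  case (Cons k ks)
  then obtain z where z: "z * prod_list (map X ks) = 1" by auto
  have "Xi k * (X k * y) = y" for y
    using mult_eq_extend[OF X_inverse(2)[of k]] Cons.prems by simp
  then show ?case
    using z by (intro exI[of _ "z * Xi k"]) (simp add: mult.assoc)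
qed

text \<open>In the relation between \<open>Y 1\<close> and the product of all \<open>X i\<close>,
  split off \<open>X 1\<close> and move \<open>Y 1\<close> across the rest \<open>?Z\<close>. This
  is the claim multiplied by \<open>?Z\<close> on the left, and \<open>?Z\<close> has a left
  inverse.\<close>

lemma loop_Y1_X1: "loop (N - 1) * (Y 1 * X 1) = emb q * (X 1 * Y 1)"
proof -
  let ?Z = "prod_list (map X [2..<N + 1])"
  have X1_Z: "X 1 * prod_list (map X ks) = prod_list (map X ks) * X 1" if "set ks \<subseteq> {1..N}" for ks
    using that
  proof (induction ks)
    case (Cons k ks)
    then have 1: "X 1 * X k = X k * X 1"
      using X_comm[of 1 k] N_pos by auto
    show ?case
      using mult_eq_extend[OF 1, of "prod_list (map X ks)"] Cons by (simp add: mult.assoc)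
  qed simp
  have comm: "X 1 * ?Z = ?Z * X 1"
    by (rule X1_Z) auto
  have split: "prod_list (map X [1..<N + 1]) = ?Z * X 1"
    unfolding comm[symmetric] using N_pos
    by (subst upt_conv_Cons) (simp_all add: numeral_2_eq_2 del: upt_Suc)
  have "?Z * (loop (N - 1) * (Y 1 * X 1)) = Y 1 * ?Z * X 1"
    using Y1_prod_X[of "N - 1"] N_pos by (simp add: mult.assoc)
  also have "\<dots> = ?Z * (emb q * (X 1 * Y 1))"
    using Y1_X unfolding split mult.assoc emb_left[of ?Z] .
  finally have eq: "?Z * (loop (N - 1) * (Y 1 * X 1)) = ?Z * (emb q * (X 1 * Y 1))" .
  have "set [2..<N + 1] \<subseteq> {1..N}"
    by auto
  then obtain z where z: "z * ?Z = 1"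
    using prod_X_left_inverse by blast
  from eq have "z * ?Z * (loop (N - 1) * (Y 1 * X 1)) = z * ?Z * (emb q * (X 1 * Y 1))"
    unfolding mult.assoc by (rule arg_cong)
  then show ?thesis
    unfolding z mult_1_left .
qed

section \<open>Partially symmetric elements and the skein relation\<close>

definition partially_symmetric :: "'a \<Rightarrow> bool" where
  "partially_symmetric R \<longleftrightarrow> (\<forall>i. 2 \<le> i \<longrightarrow> i < N \<longrightarrow> Ti i * R = emb s * R)"

lemma partially_symmetric_symmetrizer: "partially_symmetric (symmetrizer * R)"
  unfolding partially_symmetric_def
proof (intro allI impI)
  fix i assume "2 \<le> i" "i < N"
  then have "Ti i * symmetrizer = emb s * symmetrizer"
    using T_symmetrizer[of i] Ti_eigen_iff[of i symmetrizer] by simp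
  then show "Ti i * (symmetrizer * R) = emb s * (symmetrizer * R)"
    by (metis mult.assoc)
qed

lemma partially_symmetric_mult:
  assumes "partially_symmetric R" and x: "\<And>i. 2 \<le> i \<Longrightarrow> i < N \<Longrightarrow> T i * x = x * T i"
  shows "partially_symmetric (x * R)"
  unfolding partially_symmetric_def
proof (intro allI impI)
  fix i assume i: "2 \<le> i" "i < N"
  then have "x * Ti i = Ti i * x"
    using x commutes_Ti by simp
  then have "Ti i * (x * R) = x * (Ti i * R)"
    by (metis mult.assoc)
  then show "Ti i * (x * R) = emb s * (x * R)"
    using assms(1) i by (simp add: partially_symmetric_def emb_left[of x])
qed

lemma T_Yi1:
  assumes "2 \<le> i" "i < N"
  shows "T i * Yi 1 = Yi 1 * T i"
  by (rule commutes_inverse[OF T_Y1[OF assms]]) (use Y_inverse[of 1] N_pos in simp_all)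

lemma partially_symmetric_X1: "partially_symmetric R \<Longrightarrow> partially_symmetric (X 1 * R)"
  and partially_symmetric_Y1: "partially_symmetric R \<Longrightarrow> partially_symmetric (Y 1 * R)"
  and partially_symmetric_Yi1: "partially_symmetric R \<Longrightarrow> partially_symmetric (Yi 1 * R)"
  by (rule partially_symmetric_mult; use T_X1 T_Y1 T_Yi1 in blast)+

text \<open>Applied to \<open>?u\<close>, the loop gives \<open>emb q * (X 1 * R)\<close>, by
  \<open>loop_Y1_X1\<close> and cancellation of \<open>Y 1 * Yi 1\<close>. The claim is then
  \<open>symmetrizer_of_partially_symmetric\<close> for \<open>?u\<close>.\<close>

lemma skein_relation:
  assumes nz: "(\<Sum>w | w permutes {1..N}. inverse (s\<^sup>2) ^ perm_length N w) \<noteq> 0"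
    and R: "partially_symmetric R"
  shows "Y 1 * (X 1 * (Yi 1 * R)) =
    emb (q * s\<^sup>2) * (X 1 * R) + emb (1 - (s\<^sup>2) ^ N) * (symmetrizer * (Y 1 * (X 1 * (Yi 1 * R))))"
proof -
  let ?u = "Y 1 * (X 1 * (Yi 1 * R))"
  have "partially_symmetric ?u"
    by (intro partially_symmetric_X1 partially_symmetric_Y1 partially_symmetric_Yi1 R)
  then have "?u - emb (s\<^sup>2) * (loop (N - 1) * ?u) = emb (1 - (s\<^sup>2) ^ N) * (symmetrizer * ?u)"
    by (intro symmetrizer_of_partially_symmetric nz N_pos) (simp add: partially_symmetric_def)
  moreover have "loop (N - 1) * ?u = emb q * (X 1 * R)"
    using mult_eq_extend2[OF loop_Y1_X1, of "Yi 1 * R"] mult_eq_extend[OF Y_inverse(1)[of 1], of R] N_pos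
    by (simp add: mult.assoc)
  ultimately show ?thesis
    by (simp add: emb_emb mult.commute algebra_simps)
qed

end

section \<open>The highest path below a curve\<close>

abbreviation xcoord :: "step list \<Rightarrow> nat \<Rightarrow> nat" where
  "xcoord s k \<equiv> count_list (take k s) Rt"

abbreviation ycoord :: "step list \<Rightarrow> nat \<Rightarrow> nat" where
  "ycoord s k \<equiv> count_list (take k s) Up"

lemma coord_Suc:
  assumes "k < length s"
  shows "xcoord s (Suc k) = (if s ! k = Rt then Suc (xcoord s k) else xcoord s k)"
    and "ycoord s (Suc k) = (if s ! k = Up then Suc (ycoord s k) else ycoord s k)"
  using assms by (simp_all add: take_Suc_conv_app_nth)

lemma count_list_steps: "count_list s Rt + count_list s Up = length s"
proof (induction s)
  case (Cons c s)
  then show ?case by (cases c) auto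
qed simp

lemma coord_sum: "k \<le> length s \<Longrightarrow> xcoord s k + ycoord s k = k"
  using count_list_steps[of "take k s"] by simp

lemma coord_mono:
  assumes "j \<le> k"
  shows "count_list (take j s) c \<le> count_list (take k s) c"
proof -
  have "take k s = take j s @ take (k - j) (drop j s)"
    using assms by (metis take_add le_add_diff_inverse)
  then show ?thesis
    by simp
qed

lemma coord_le_total: "count_list (take k s) c \<le> count_list s c"
  by (metis append_take_drop_id count_list_append le_add1)

lemma ex_right_step: "i < count_list s Rt \<Longrightarrow> \<exists>k<length s. s ! k = Rt \<and> xcoord s k = i"
proof (induction s arbitrary: i)
  case (Cons c s)
  show ?case
  proof (cases "c = Rt \<and> i = 0")
    case True
    then show ?thesis by (intro exI[of _ 0]) simp
  next
    case False
    then have "(if c = Rt then i - 1 else i) < count_list s Rt"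
      using Cons.prems by auto
    then obtain k where "k < length s" "s ! k = Rt" "xcoord s k = (if c = Rt then i - 1 else i)"
      using Cons.IH by blast
    then show ?thesis
      using False by (intro exI[of _ "Suc k"]) auto
  qed
qed simp

lemma vertex_in_path_points:
  assumes "k \<le> length s" "s \<noteq> []"
  shows "vertex s k \<in> path_points s"
proof (cases "k < length s")
  case True
  then show ?thesis by (auto simp: path_points_def)
next
  case False
  then obtain j where "k = Suc j" "j < length s"
    using assms by (cases k) auto
  then show ?thesis by (auto simp: path_points_def)
qed

lemma right_step_in_path_points:
  assumes "k < length s" "s ! k = Rt" "real (xcoord s k) \<le> x" "x \<le> real (xcoord s k) + 1"
  shows "(x, real (ycoord s k)) \<in> path_points s"
proof -
  let ?u = "x - real (xcoord s k)"
  have "(x, real (ycoord s k)) = (1 - ?u) *\<^sub>R vertex s k + ?u *\<^sub>R vertex s (Suc k)"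
    using assms coord_Suc[of k s] by (simp add: vertex_def algebra_simps)
  then have "(x, real (ycoord s k)) \<in> closed_segment (vertex s k) (vertex s (Suc k))"
    using assms unfolding in_segment by (intro exI[of _ ?u]) simp
  then show ?thesis
    using assms by (auto simp: path_points_def)
qed

text \<open>Reduces points to vertices: each point is dominated by a vertex of its column, a column
  being a half-open strip of width one. Hence the upper end of an up step is taken, and at the right
  end of a right step the next vertex.\<close>

lemma path_points_bound:
  assumes "(x, y) \<in> path_points s"
  obtains k where "k \<le> length s" "real (xcoord s k) \<le> x" "x < real (xcoord s k) + 1"
    "x \<le> real (count_list s Rt)" "y \<le> real (ycoord s k)"
proof -
  obtain k where k: "k < length s" "(x, y) \<in> closed_segment (vertex s k) (vertex s (Suc k))"
    using assms by (auto simp: path_points_def)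
  then obtain u where u: "0 \<le> u" "u \<le> 1" "(x, y) = (1 - u) *\<^sub>R vertex s k + u *\<^sub>R vertex s (Suc k)"
    by (auto simp: in_segment)
  have le: "xcoord s (Suc k) \<le> count_list s Rt"
    by (rule coord_le_total)
  show ?thesis
  proof (cases "s ! k")
    case Up
    then have "x = real (xcoord s k)" "y = real (ycoord s k) + u"
      using u(3) k coord_Suc[of k s] by (simp_all add: vertex_def algebra_simps)
    then show ?thesis
      using that[of "Suc k"] Up k u le coord_Suc[of k s] by simp
  next
    case Rt
    then have xy: "x = real (xcoord s k) + u" "y = real (ycoord s k)"
      using u(3) k coord_Suc[of k s] by (simp_all add: vertex_def algebra_simps)
    show ?thesis
    proof (cases "u < 1")
      case True
      then show ?thesis
        using that[of k] Rt k u le xy coord_Suc[of k s] by simp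
    next
      case False
      then show ?thesis
        using that[of "Suc k"] Rt k u le xy coord_Suc[of k s] by simp
    qed
  qed
qed

text \<open>A local rule for the highest path: go up unless the vertex reached would lie strictly
  above the curve. It sees the curve only through its position relative to lattice points, so that
  paths of different curves can be compared.\<close>

definition greedy_path :: "nat \<Rightarrow> nat \<Rightarrow> (real \<times> real) set \<Rightarrow> step list \<Rightarrow> bool" where
  "greedy_path m n C s \<longleftrightarrow> lattice_path m n s \<and> (\<forall>k<length s. s ! k = Up \<longleftrightarrow>
     \<not> passes_below C (real (xcoord s k), real (Suc (ycoord s k))))"

section \<open>Existence and uniqueness of the highest path\<close>

locale curve =
  fixes m n :: nat and f :: "real \<Rightarrow> real" and C :: "(real \<times> real) set"
  assumes mono: "strict_mono_on {0..real m} f"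
    and f_0: "f 0 = 0" and f_m: "f (real m) = real n"
    and C_eq: "C = (\<lambda>x. (x, f x)) ` {0..real m}"
    and m_pos: "1 \<le> m"
begin

lemma mem_C_iff: "(x, y) \<in> C \<longleftrightarrow> 0 \<le> x \<and> x \<le> real m \<and> y = f x"
  by (auto simp: C_eq)

lemma passes_below_iff: "passes_below C (x, y) \<longleftrightarrow> 0 \<le> x \<and> x \<le> real m \<and> f x < y"
  by (auto simp: passes_below_def mem_C_iff)

lemma f_mono: "0 \<le> x \<Longrightarrow> x \<le> y \<Longrightarrow> y \<le> real m \<Longrightarrow> f x \<le> f y"
  using strict_mono_onD[OF mono, of x y] by (cases "x = y") auto

text \<open>Since \<open>f\<close> is increasing, a point of the path is below the curve as soon as
  the vertex dominating it from the left is.\<close>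

lemma weakly_below_iff:
  assumes s: "lattice_path m n s"
  shows "weakly_below (path_points s) C \<longleftrightarrow>
    (\<forall>k\<le>length s. real (ycoord s k) \<le> f (real (xcoord s k)))"
proof
  assume below: "weakly_below (path_points s) C"
  have "s \<noteq> []"
    using s m_pos by (auto simp: lattice_path_def)
  then show "\<forall>k\<le>length s. real (ycoord s k) \<le> f (real (xcoord s k))"
    using below vertex_in_path_points[of _ s] by (force simp: weakly_below_def vertex_def mem_C_iff)
next
  assume below: "\<forall>k\<le>length s. real (ycoord s k) \<le> f (real (xcoord s k))"
  show "weakly_below (path_points s) C"
    unfolding weakly_below_def
  proof clarify
    fix x y assume "(x, y) \<in> path_points s"
    then obtain k where k: "k \<le> length s" "real (xcoord s k) \<le> x" "x \<le> real (count_list s Rt)"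
      "y \<le> real (ycoord s k)"
      by (rule path_points_bound)
    then have "y \<le> f x" "0 \<le> x" "x \<le> real m"
      using below f_mono[of "real (xcoord s k)" x] s by (force simp: lattice_path_def)+
    then show "\<exists>y'. (x, y') \<in> C \<and> y \<le> y'"
      by (auto simp: mem_C_iff)
  qed
qed

lemma xcoord_le: "lattice_path m n s \<Longrightarrow> xcoord s k \<le> m"
  using coord_le_total[of k s Rt] by (simp add: lattice_path_def)

lemma greedy_path_below:
  assumes s: "greedy_path m n C s"
  shows "weakly_below (path_points s) C"
proof -
  have l: "lattice_path m n s"
    using s by (simp add: greedy_path_def)
  have "real (ycoord s k) \<le> f (real (xcoord s k))" if "k \<le> length s" for k
    using that
  proof (induction k)
    case 0
    then show ?case by (simp add: f_0)
  next
    case (Suc k)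
    then have k: "k < length s" by simp
    show ?case
    proof (cases "s ! k")
      case Up
      then have "\<not> passes_below C (real (xcoord s k), real (Suc (ycoord s k)))"
        using s k by (simp add: greedy_path_def)
      then show ?thesis
        using coord_Suc[OF k] Up xcoord_le[OF l, of k] by (simp add: passes_below_iff)
    next
      case Rt
      then have "f (real (xcoord s k)) \<le> f (real (xcoord s (Suc k)))"
        using coord_Suc[OF k] xcoord_le[OF l, of "Suc k"] by (intro f_mono) auto
      then show ?thesis
        using Suc coord_Suc[OF k] Rt by simp
    qed
  qed
  then show ?thesis
    by (simp add: weakly_below_iff[OF l])
qed

lemma greedy_path_right_step:
  assumes "greedy_path m n C s" "i < m"
  obtains k where "k < length s" "s ! k = Rt" "xcoord s k = i" "f (real i) < real (Suc (ycoord s k))"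
proof -
  obtain k where k: "k < length s" "s ! k = Rt" "xcoord s k = i"
    using ex_right_step[of i s] assms by (auto simp: greedy_path_def lattice_path_def)
  then have "passes_below C (real i, real (Suc (ycoord s k)))"
    using assms by (auto simp: greedy_path_def)
  then show ?thesis
    using that k by (simp add: passes_below_iff)
qed

text \<open>Before the last column, the greedy path leaves each column at the largest integer height
  below the curve, which bounds the other path there. In the last column its end point
  \<open>(m, n)\<close> dominates.\<close>

lemma greedy_path_highest:
  assumes s: "greedy_path m n C s" and s': "lattice_path m n s'" "weakly_below (path_points s') C"
  shows "weakly_below (path_points s') (path_points s)"
  unfolding weakly_below_def
proof clarify
  fix x y assume "(x, y) \<in> path_points s'"
  then obtain k where k: "k \<le> length s'" "real (xcoord s' k) \<le> x" "x < real (xcoord s' k) + 1"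
    "x \<le> real m" "y \<le> real (ycoord s' k)"
    using path_points_bound s'(1) by (metis lattice_path_def)
  have yf: "real (ycoord s' k) \<le> f (real (xcoord s' k))"
    using s' weakly_below_iff k(1) by blast
  show "\<exists>y'. (x, y') \<in> path_points s \<and> y \<le> y'"
  proof (cases "xcoord s' k < m")
    case True
    obtain j where j: "j < length s" "s ! j = Rt" "xcoord s j = xcoord s' k"
      "f (real (xcoord s' k)) < real (Suc (ycoord s j))"
      by (rule greedy_path_right_step[OF s True])
    then have "ycoord s' k \<le> ycoord s j"
      using yf by linarith
    then have "y \<le> real (ycoord s j)"
      using k(5) by linarith
    moreover have "(x, real (ycoord s j)) \<in> path_points s"
      by (rule right_step_in_path_points) (use j k in auto)
    ultimately show ?thesis by blast
  next
    case False
    then have x: "x = real m" "xcoord s' k = m"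
      using k xcoord_le[OF s'(1), of k] by linarith+
    have l: "lattice_path m n s"
      using s by (simp add: greedy_path_def)
    then have "s \<noteq> []"
      using m_pos by (auto simp: lattice_path_def)
    then have "(real m, real n) \<in> path_points s"
      using vertex_in_path_points[of "length s" s] l by (simp add: vertex_def lattice_path_def)
    moreover have "y \<le> real n"
      using k yf x f_m by simp
    ultimately show ?thesis
      using x by blast
  qed
qed

text \<open>This supplies the uniqueness required by \<open>THE\<close>. An up step of a path below
  the curve always obeys the rule. At a right step, comparison with the greedy path in the same
  column shows that the largest admissible height has been reached.\<close>

lemma greedy_path_of_highest:
  assumes s: "greedy_path m n C s"
    and s': "lattice_path m n s'" "weakly_below (path_points s') C"
    and high: "weakly_below (path_points s) (path_points s')"
  shows "greedy_path m n C s'"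
proof -
  have "s' ! k = Up \<longleftrightarrow> \<not> passes_below C (real (xcoord s' k), real (Suc (ycoord s' k)))"
    if k: "k < length s'" for k
  proof (cases "s' ! k")
    case Up
    have "real (ycoord s' (Suc k)) \<le> f (real (xcoord s' (Suc k)))"
      using s' weakly_below_iff k by (metis Suc_leI)
    then show ?thesis
      using Up coord_Suc[OF k] by (simp add: passes_below_iff)
  next
    case Rt
    have i: "xcoord s' k < m"
      using xcoord_le[OF s'(1), of "Suc k"] coord_Suc[OF k] Rt by simp
    obtain j where j: "j < length s" "s ! j = Rt" "xcoord s j = xcoord s' k"
      "f (real (xcoord s' k)) < real (Suc (ycoord s j))"
      by (rule greedy_path_right_step[OF s i])
    have "vertex s j \<in> path_points s"
      using j by (intro vertex_in_path_points) auto
    then obtain y where y: "(real (xcoord s' k), y) \<in> path_points s'" "real (ycoord s j) \<le> y"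
      using high j unfolding weakly_below_def vertex_def by force
    obtain k' where k': "k' \<le> length s'" "real (xcoord s' k') \<le> real (xcoord s' k)"
      "y \<le> real (ycoord s' k')"
      using path_points_bound[OF y(1)] by metis
    \<comment> \<open>The dominating vertex is not to the right of the column that step
      \<open>k\<close> leaves, so it precedes that step.\<close>
    have "k' \<le> k"
    proof (rule ccontr)
      assume "\<not> k' \<le> k"
      then have "xcoord s' (Suc k) \<le> xcoord s' k'"
        by (intro coord_mono) simp
      then show False
        using k' coord_Suc[OF k] Rt by simp
    qed
    then have "ycoord s' k' \<le> ycoord s' k"
      by (rule coord_mono)
    then have "f (real (xcoord s' k)) < real (Suc (ycoord s' k))"
      using j y k' by simp
    then show ?thesis
      using Rt i by (simp add: passes_below_iff)
  qed
  then show ?thesis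
    using s' by (simp add: greedy_path_def)
qed

text \<open>Steps are appended by the rule up to length \<open>m + n\<close>; the invariant keeps
  the partial path inside the rectangle and below the curve.\<close>

lemma ex_greedy_path: "\<exists>s. greedy_path m n C s"
proof -
  have "\<exists>s. length s = j \<and> count_list s Rt \<le> m \<and> count_list s Up \<le> n \<and>
      real (count_list s Up) \<le> f (real (count_list s Rt)) \<and>
      (\<forall>k<length s. s ! k = Up \<longleftrightarrow> \<not> passes_below C (real (xcoord s k), real (Suc (ycoord s k))))"
    if "j \<le> m + n" for j
    using that
  proof (induction j)
    case 0
    then show ?case by (simp add: f_0)
  next
    case (Suc j)
    then obtain s where s: "length s = j" "count_list s Rt \<le> m" "count_list s Up \<le> n"
      "real (count_list s Up) \<le> f (real (count_list s Rt))"
      "\<And>k. k < length s \<Longrightarrow> s ! k = Up \<longleftrightarrow> \<not> passes_below C (real (xcoord s k), real (Suc (ycoord s k)))"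
      by auto
    let ?P = "passes_below C (real (count_list s Rt), real (Suc (count_list s Up)))"
    let ?s = "s @ [if ?P then Rt else Up]"
    have steps: "?s ! k = Up \<longleftrightarrow> \<not> passes_below C (real (xcoord ?s k), real (Suc (ycoord ?s k)))"
      if "k < length ?s" for k
    proof (cases "k < length s")
      case True
      then show ?thesis using s(5)[of k] by (simp add: nth_append)
    next
      case False
      then have "k = length s" using that by simp
      then show ?thesis by simp
    qed
    have sum: "count_list s Rt + count_list s Up < m + n"
      using count_list_steps[of s] s(1) Suc.prems by simp
    show ?case
    proof (cases ?P)
      case True
      \<comment> \<open>In the last column the curve has height \<open>n\<close>, so a forced right
        step there would mean that the path already has full length.\<close>
      have "count_list s Rt < m"
      proof (rule ccontr)
        assume "\<not> count_list s Rt < m"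
        then have "count_list s Rt = m" using s(2) by simp
        then show False
          using True f_m sum by (simp add: passes_below_iff)
      qed
      moreover from this have "f (real (count_list s Rt)) \<le> f (real (Suc (count_list s Rt)))"
        by (intro f_mono) auto
      ultimately show ?thesis
        using s(1-4) steps True by (intro exI[of _ ?s]) auto
    next
      case False
      then have *: "real (Suc (count_list s Up)) \<le> f (real (count_list s Rt))"
        using s(2) by (simp add: passes_below_iff)
      also have "\<dots> \<le> real n"
        using f_mono[of "real (count_list s Rt)" "real m"] s(2) f_m by simp
      finally have "Suc (count_list s Up) \<le> n"
        by simp
      then show ?thesis
        using s(1-4) steps False * by (intro exI[of _ ?s]) auto
    qed
  qed
  from this[of "m + n"] obtain s where s: "length s = m + n" "count_list s Rt \<le> m" "count_list s Up \<le> n"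
    "\<And>k. k < length s \<Longrightarrow> s ! k = Up \<longleftrightarrow> \<not> passes_below C (real (xcoord s k), real (Suc (ycoord s k)))"
    by auto
  then have "lattice_path m n s"
    using count_list_steps[of s] by (simp add: lattice_path_def)
  then show ?thesis
    using s(4) by (auto simp: greedy_path_def)
qed

end

text \<open>The rule determines each step from the vertex reached before it.\<close>

lemma greedy_path_unique:
  assumes "greedy_path m n C s" "greedy_path m n C s'"
  shows "s = s'"
proof -
  have len: "length s = length s'"
    using assms count_list_steps[of s] count_list_steps[of s']
    by (simp add: greedy_path_def lattice_path_def)
  have "take k s = take k s'" if "k \<le> length s" for k
    using that
  proof (induction k)
    case (Suc k)
    then have eq: "take k s = take k s'" and k: "k < length s" "k < length s'"
      using len by auto
    have "s ! k = Up \<longleftrightarrow> s' ! k = Up"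
      using assms k eq by (simp add: greedy_path_def)
    then have "s ! k = s' ! k"
      by (metis step.exhaust)
    then show ?case
      using eq k by (simp add: take_Suc_conv_app_nth)
  qed simp
  then show ?thesis
    using len by (metis le_refl take_all_iff)
qed

lemma curve_of_monotone_curve:
  assumes "monotone_curve m n C" "1 \<le> m"
  obtains f where "curve m n f C"
  using assms by (auto simp: monotone_curve_def curve_def)

lemma highest_path_eq_greedy:
  assumes C: "monotone_curve m n C" "1 \<le> m" and s: "greedy_path m n C s"
  shows "highest_path m n C = s"
proof -
  obtain f where "curve m n f C"
    using curve_of_monotone_curve[OF C] .
  then interpret curve m n f C .
  show ?thesis
    unfolding highest_path_def
  proof (rule the_equality)
    show "lattice_path m n s \<and> weakly_below (path_points s) C \<and>
      (\<forall>s'. lattice_path m n s' \<and> weakly_below (path_points s') C \<longrightarrow>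
        weakly_below (path_points s') (path_points s))"
      using s greedy_path_below greedy_path_highest by (auto simp: greedy_path_def)
  next
    fix s' assume s': "lattice_path m n s' \<and> weakly_below (path_points s') C \<and>
      (\<forall>s''. lattice_path m n s'' \<and> weakly_below (path_points s'') C \<longrightarrow>
        weakly_below (path_points s'') (path_points s'))"
    then have "greedy_path m n C s'"
      using greedy_path_of_highest[OF s, of s'] s greedy_path_below[OF s]
      by (auto simp: greedy_path_def)
    then show "s' = s"
      using greedy_path_unique s by blast
  qed
qed

section \<open>Marked paths of three curves around a lattice point\<close>

definition marked_path :: "nat \<Rightarrow> nat \<Rightarrow> (real \<times> real) set \<Rightarrow> (bool \<times> step) list" where
  "marked_path m n C = (let s = highest_path m n C in
     map (\<lambda>k. (vertex s k \<in> C, s ! k)) [0..<length s])"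

text \<open>The greedy rules of the three curves differ only at \<open>p\<close>. The path of
  \<open>C_zero\<close> enters \<open>p\<close> by an up step and leaves by a right step;
  \<open>C_plus\<close> has the same path with \<open>p\<close> unmarked; for \<open>C_minus\<close>
  the point \<open>p\<close> is too high, and the corner is flipped.\<close>

lemma marked_paths_of_curves_at_lattice_point:
  fixes p :: "int \<times> int"
  assumes mn: "1 \<le> m"
    and curves: "monotone_curve m n C_plus" "monotone_curve m n C_minus" "monotone_curve m n C_zero"
    and p: "passes_above C_plus (lattice_pt p)" "passes_below C_minus (lattice_pt p)"
      "lattice_pt p \<in> C_zero"
    and r: "r \<le> 1"
    and eq: "C_plus - ball (lattice_pt p) r = C_zero - ball (lattice_pt p) r"
      "C_minus - ball (lattice_pt p) r = C_zero - ball (lattice_pt p) r"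
  shows "\<exists>A B b. marked_path m n C_plus = A @ [(b, Up), (False, Rt)] @ B \<and>
    marked_path m n C_minus = A @ [(b, Rt), (False, Up)] @ B \<and>
    marked_path m n C_zero = A @ [(b, Up), (True, Rt)] @ B"
proof -
  obtain f_plus where "curve m n f_plus C_plus"
    using curve_of_monotone_curve[OF curves(1) mn] .
  then interpret plus: curve m n f_plus C_plus .
  obtain f_minus where "curve m n f_minus C_minus"
    using curve_of_monotone_curve[OF curves(2) mn] .
  then interpret minus: curve m n f_minus C_minus .
  obtain f where "curve m n f C_zero"
    using curve_of_monotone_curve[OF curves(3) mn] .
  then interpret curve m n f C_zero .
  obtain pa pb where p_def: "p = (pa, pb)" by (cases p)
  have p_plus: "lattice_pt p \<notin> C_plus" and p_minus: "lattice_pt p \<notin> C_minus"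
    using p by (auto simp: lattice_pt_def passes_above_def passes_below_def plus.mem_C_iff minus.mem_C_iff)
  note pos_plus = same_position(2,3)[OF curves(1,3) p(3) p_plus r eq(1)]
  note pos_minus = same_position(2,3)[OF curves(2,3) p(3) p_minus r eq(2)]
  have pab: "0 \<le> real_of_int pa" "real_of_int pa \<le> real m" "f (real_of_int pa) = real_of_int pb"
    using p(3) by (simp_all add: p_def lattice_pt_def mem_C_iff)
  have "f_plus (real_of_int pa) > f (real_of_int pa)"
    using p(1) pab by (auto simp: p_def lattice_pt_def passes_above_def plus.mem_C_iff)
  \<comment> \<open>All curves share their end points, so \<open>p\<close> does not lie over an end
    of the interval.\<close>
  then have "real_of_int pa \<noteq> 0" "real_of_int pa \<noteq> real m"
    using f_0 f_m plus.f_0 plus.f_m by auto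
  then have pa: "0 < pa" "pa < int m"
    using pab by linarith+
  have "f 0 < f (real_of_int pa)"
    by (rule strict_mono_onD[OF mono]) (use pa pab in auto)
  then have pb: "0 < pb"
    using pab f_0 by simp
  define a b where "a = nat pa" and "b = nat (pb - 1)"
  have ab: "pa = int a" "pb = int (Suc b)"
    using pa pb by (auto simp: a_def b_def)
  have p_eq: "p = (int a, int (Suc b))" and a: "0 < a" "a < m" and fa: "f (real a) = real (Suc b)"
    using p_def pab pa ab by auto
  have lat: "(real i, real j) = lattice_pt (int i, int j)" for i j :: nat
    by (simp add: lattice_pt_def)
  obtain s where s: "greedy_path m n C_zero s"
    using ex_greedy_path by blast
  have path: "lattice_path m n s"
    using s by (simp add: greedy_path_def)
  have below: "real (ycoord s k) \<le> f (real (xcoord s k))" if "k \<le> length s" for k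
    using greedy_path_below[OF s] weakly_below_iff[OF path] that by blast
  obtain k where k: "k < length s" "s ! k = Rt" "xcoord s k = a" "f (real a) < real (Suc (ycoord s k))"
    by (rule greedy_path_right_step[OF s a(2)])
  \<comment> \<open>The path is below the curve, whose height here is \<open>Suc b\<close>, while
    the next lattice point is above it.\<close>
  have yk: "ycoord s k = Suc b"
    using k below[of k] fa by simp
  have ksum: "k = a + Suc b"
    using coord_sum[of k s] k yk by simp
  define l where "l = a + b"
  have kl: "k = Suc l"
    using ksum by (simp add: l_def)
  have l: "l < length s" "Suc l < length s"
    using k kl by auto
  \<comment> \<open>A right step into \<open>p\<close> would start at height \<open>Suc b\<close> in
    column \<open>a - 1\<close>, where the increasing curve is still lower.\<close>
  have Up_l: "s ! l = Up"
  proof (rule ccontr)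
    assume "s ! l \<noteq> Up"
    then have "s ! l = Rt" by (cases "s ! l") auto
    then have "xcoord s l = a - 1" "ycoord s l = Suc b"
      using coord_Suc[OF l(1)] k yk kl by auto
    then have "real (Suc b) \<le> f (real (a - 1))"
      using below[of l] l by simp
    moreover have "f (real (a - 1)) < f (real a)"
      by (rule strict_mono_onD[OF mono]) (use a in auto)
    ultimately show False
      using fa by simp
  qed
  have vl: "xcoord s l = a" "ycoord s l = b"
    using coord_Suc[OF l(1)] k yk kl Up_l by auto
  define u v where "u = take l s" and "v = drop (Suc (Suc l)) s"
  have s_eq: "s = u @ [Up, Rt] @ v"
  proof -
    have "drop l s = [Up, Rt] @ v"
      using Cons_nth_drop_Suc[OF l(1)] Cons_nth_drop_Suc[OF l(2)] Up_l k(2) kl by (simp add: v_def)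
    then show ?thesis
      by (metis append_take_drop_id u_def)
  qed
  define s' where "s' = u @ [Rt, Up] @ v"
  have lu: "length u = l"
    using l by (simp add: u_def)
  have len: "length s' = length s"
    by (simp add: s_eq s'_def)
  have cu: "count_list u Rt = a" "count_list u Up = b"
    using vl by (simp_all add: u_def)
  have coords: "xcoord s' j = xcoord s j" "ycoord s' j = ycoord s j" if jl: "j \<noteq> Suc l" for j
  proof -
    consider "j \<le> l" | "Suc (Suc l) \<le> j"
      using jl by linarith
    then have "xcoord s' j = xcoord s j \<and> ycoord s' j = ycoord s j"
    proof cases
      case 1
      then show ?thesis by (simp add: s_eq s'_def lu)
    next
      case 2
      then obtain i where "j = Suc (Suc l) + i"
        using le_Suc_ex by blast
      then show ?thesis by (simp add: s_eq s'_def lu)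
    qed
    then show "xcoord s' j = xcoord s j" "ycoord s' j = ycoord s j" by auto
  qed
  have coords_l: "xcoord s' (Suc l) = Suc a" "ycoord s' (Suc l) = b"
    using cu by (simp_all add: s'_def lu)
  have nth: "s' ! j = s ! j" if "j \<noteq> l" "j \<noteq> Suc l" for j
    using that by (auto simp: s_eq s'_def nth_append lu nth_Cons split: nat.split)
  have nth_l: "s' ! l = Rt" "s' ! Suc l = Up"
    by (simp_all add: s'_def nth_append lu)
  \<comment> \<open>The coordinates of the vertex with index \<open>j\<close> add up to
    \<open>j\<close>, so \<open>p\<close> can occur only at index \<open>Suc l\<close>.\<close>
  have not_p: "(int (xcoord s j), int (ycoord s j)) \<noteq> p" if "j \<le> length s" "j \<noteq> Suc l" for j
    using coord_sum[of j s] that ksum kl by (auto simp: p_eq)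
  have not_p_Suc: "(int (xcoord s j), int (Suc (ycoord s j))) \<noteq> p" if "j \<le> length s" "j \<noteq> l" for j
    using coord_sum[of j s] that ksum kl by (auto simp: p_eq)
  have s_plus: "greedy_path m n C_plus s"
    unfolding greedy_path_def
  proof (intro conjI allI impI path)
    fix j assume j: "j < length s"
    show "s ! j = Up \<longleftrightarrow> \<not> passes_below C_plus (real (xcoord s j), real (Suc (ycoord s j)))"
    proof (cases "j = l")
      case True
      have "\<not> passes_below C_plus (lattice_pt p)"
        using p(1) by (auto simp: passes_above_def lattice_pt_def plus.passes_below_iff plus.mem_C_iff)
      then show ?thesis
        using True Up_l vl by (simp add: lat p_eq del: of_nat_Suc)
    next
      case False
      then show ?thesis
        using s j pos_plus(1)[OF not_p_Suc[of j]] by (simp add: greedy_path_def lat del: of_nat_Suc)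
    qed
  qed
  have s_minus: "greedy_path m n C_minus s'"
    unfolding greedy_path_def
  proof (intro conjI allI impI)
    show "lattice_path m n s'"
      using path by (simp add: lattice_path_def s_eq s'_def)
    fix j assume "j < length s'"
    then have j: "j < length s" by (simp add: len)
    consider "j = l" | "j = Suc l" | "j \<noteq> l" "j \<noteq> Suc l" by blast
    then show "s' ! j = Up \<longleftrightarrow> \<not> passes_below C_minus (real (xcoord s' j), real (Suc (ycoord s' j)))"
    proof cases
      case 1
      then show ?thesis
        using p(2) nth_l vl coords[of l] by (simp add: lat p_eq del: of_nat_Suc)
    next
      case 2
      \<comment> \<open>The flipped corner is \<open>(Suc a, b)\<close>. The curve exceeds
        \<open>Suc b\<close> to the right of \<open>p\<close>, so an up step from that corner is
        allowed.\<close>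
      have "\<not> passes_below C_zero (real (Suc a), real (Suc b))"
        using strict_mono_onD[OF mono, of "real a" "real (Suc a)"] a fa
        by (auto simp: passes_below_iff)
      then have "\<not> passes_below C_minus (real (Suc a), real (Suc b))"
        using pos_minus(1)[of "(int (Suc a), int (Suc b))"] by (simp add: lat p_eq del: of_nat_Suc)
      then show ?thesis
        using 2 nth_l coords_l by simp
    next
      case 3
      then show ?thesis
        using s j pos_minus(1)[OF not_p_Suc[of j]] nth coords
        by (simp add: greedy_path_def lat del: of_nat_Suc)
    qed
  qed
  note hp = highest_path_eq_greedy[OF curves(1) mn s_plus] highest_path_eq_greedy[OF curves(2) mn s_minus]
    highest_path_eq_greedy[OF curves(3) mn s]
  let ?M = "\<lambda>C s. \<lambda>k. (vertex s k \<in> C, s ! k)"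
  have vertex_lat: "vertex s k = lattice_pt (int (xcoord s k), int (ycoord s k))" for s k
    by (simp add: vertex_def lattice_pt_def)
  have mark_plus: "vertex s j \<in> C_plus \<longleftrightarrow> vertex s j \<in> C_zero" if "j \<le> length s" "j \<noteq> Suc l" for j
    using pos_plus(2)[OF not_p[OF that]] by (simp add: vertex_lat)
  have mark_minus: "vertex s' j \<in> C_minus \<longleftrightarrow> vertex s j \<in> C_zero" if "j \<le> length s" "j \<noteq> Suc l" for j
    using pos_minus(2)[OF not_p[OF that]] coords[OF that(2)] by (simp add: vertex_lat)
  have vk: "vertex s (Suc l) = lattice_pt p"
    using k yk kl by (simp add: vertex_lat p_eq)
  \<comment> \<open>By the same inequality the flipped corner is strictly below the curve, hence
    unmarked.\<close>
  have "vertex s' (Suc l) \<notin> C_zero"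
    using strict_mono_onD[OF mono, of "real a" "real (Suc a)"] a fa coords_l
    by (auto simp: vertex_def mem_C_iff)
  then have mark_minus_l: "vertex s' (Suc l) \<notin> C_minus"
    using pos_minus(2)[of "(int (Suc a), int b)"] coords_l by (simp add: vertex_lat p_eq)
  have split: "[0..<length s] = [0..<l] @ [l, Suc l] @ [Suc (Suc l)..<length s]"
    using l upt_add_eq_append[of 0 l "length s - l"] by (simp add: upt_conv_Cons)
  show ?thesis
  proof (intro exI conjI)
    let ?A = "map (?M C_zero s) [0..<l]" and ?B = "map (?M C_zero s) [Suc (Suc l)..<length s]"
      and ?b = "vertex s l \<in> C_zero"
    show "marked_path m n C_plus = ?A @ [(?b, Up), (False, Rt)] @ ?B"
      unfolding marked_path_def hp Let_def split
      using mark_plus l Up_l k(2) kl vk p_plus by simp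
    show "marked_path m n C_minus = ?A @ [(?b, Rt), (False, Up)] @ ?B"
      unfolding marked_path_def hp Let_def len split
      using mark_minus mark_minus_l l nth_l nth by simp
    show "marked_path m n C_zero = ?A @ [(?b, Up), (True, Rt)] @ ?B"
      unfolding marked_path_def hp Let_def split
      using l Up_l k(2) kl vk p(3) by simp
  qed
qed

section \<open>Computing in the quotient\<close>

lemma t_half_nonzero: "t_half \<noteq> 0"
  by (simp add: t_half_def Zero_fract_def eq_fract)

text \<open>A power of \<open>t_par\<close> clears the inverses and leaves a polynomial in the
  square root of t. Its value at 1 is the number of permutations, which is not zero.\<close>

lemma poincare_nonzero: "(\<Sum>w | w permutes {1..N}. inverse t_par ^ perm_length N w) \<noteq> 0"
proof
  let ?W = "{w. w permutes {1..N}}" and ?l = "perm_length N"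
  \<comment> \<open>The sum of all lengths bounds each of them.\<close>
  let ?M = "\<Sum>w\<in>?W. ?l w" and ?x = "[:0, 1:] :: complex poly poly"
  have fin: "finite ?W"
    by (simp add: finite_permutations)
  have pow: "Fract a 1 ^ k = Fract (a ^ k) 1" for a :: "complex poly poly" and k
    by (induction k) (simp_all add: One_fract_def)
  have sum: "(\<Sum>w\<in>A. Fract (g w) 1) = Fract (\<Sum>w\<in>A. g w) 1"
    for A :: "(nat \<Rightarrow> nat) set" and g :: "_ \<Rightarrow> complex poly poly"
    by (induction A rule: infinite_finite_induct) (simp_all add: Zero_fract_def)
  have t: "t_par \<noteq> 0"
    using t_half_nonzero by (simp add: t_par_def)
  assume "(\<Sum>w\<in>?W. inverse t_par ^ ?l w) = 0"
  then have "0 = t_par ^ ?M * (\<Sum>w\<in>?W. inverse t_par ^ ?l w)"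
    by simp
  also have "\<dots> = (\<Sum>w\<in>?W. t_par ^ (?M - ?l w))"
    unfolding sum_distrib_left
  proof (rule sum.cong)
    fix w assume "w \<in> ?W"
    then have "?l w \<le> ?M"
      using fin by (intro member_le_sum) auto
    then show "t_par ^ ?M * inverse t_par ^ ?l w = t_par ^ (?M - ?l w)"
      using t by (simp add: power_diff power_inverse divide_inverse)
  qed simp
  also have "\<dots> = Fract (\<Sum>w\<in>?W. (?x ^ 2) ^ (?M - ?l w)) 1"
    unfolding t_par_def t_half_def pow sum ..
  finally have "(\<Sum>w\<in>?W. (?x ^ 2) ^ (?M - ?l w)) = 0"
    by (simp add: Zero_fract_def eq_fract)
  then have "poly (\<Sum>w\<in>?W. (?x ^ 2) ^ (?M - ?l w)) 1 = 0"
    by simp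
  then have "(of_nat (card ?W) :: complex poly) = 0"
    by (simp add: poly_sum)
  then have "?W = {}"
    using fin by simp
  then show False
    using permutes_id[of "{1..N}"] by blast
qed

section \<open>Arithmetic of residue classes\<close>

lemma free_alg_sum_in: "(\<And>x. x \<in> A \<Longrightarrow> f x \<in> carrier (free_alg N)) \<Longrightarrow> sum f A \<in> carrier (free_alg N)"
  by (induction A rule: infinite_finite_induct) (auto intro: free_closed)

lemma gTw_in: "w permutes {1..N} \<Longrightarrow> gTw N w \<in> carrier (free_alg N)"
  unfolding gTw_def using some_reduced_word[of w N]
  by (intro prod_list_in) (auto simp: reduced_word_def letters_of_def intro!: gen_in)

lemma ge_in: "ge N \<in> carrier (free_alg N)"
  unfolding ge_def by (intro mult_in sc_in free_alg_sum_in) (auto intro: gTw_in)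

lemma carrier_DAHA: "carrier (DAHA N) = cls N ` carrier (free_alg N)"
  by (auto simp: DAHA_def Let_def FactRing_def A_RCOSETS_def' cls_def)

lemma cls_ops:
  assumes "1 \<le> N" "a \<in> carrier (free_alg N)" "b \<in> carrier (free_alg N)"
  shows "cls N a \<oplus>\<^bsub>DAHA N\<^esub> cls N b = cls N (a + b)"
    and "cls N a \<otimes>\<^bsub>DAHA N\<^esub> cls N b = cls N (a * b)"
proof -
  interpret ideal "daha_ideal N" "free_alg N"
    by (rule ideal_daha_ideal[OF assms(1)])
  show "cls N a \<oplus>\<^bsub>DAHA N\<^esub> cls N b = cls N (a + b)"
    using a_rcos_sum[OF assms(2,3)] by (simp add: DAHA_def Let_def FactRing_def cls_def)
  show "cls N a \<otimes>\<^bsub>DAHA N\<^esub> cls N b = cls N (a * b)"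
    using rcoset_mult_add[OF assms(2,3)] by (simp add: DAHA_def Let_def FactRing_def cls_def)
qed

lemma cls_smult:
  assumes "1 \<le> N" "a \<in> carrier (free_alg N)"
  shows "c \<odot>\<^bsub>DAHA N\<^esub> cls N a = cls N (sc c * a)"
  using cls_ops(2)[OF assms(1) sc_in assms(2), of c] by (simp add: DAHA_def Let_def)

lemma cls_rel: "daha_rel N a b \<Longrightarrow> 1 \<le> N \<Longrightarrow> cls N a = cls N b"
  by (rule cls_eqI[OF _ refl]) (auto dest: daha_rel_in)

fun mark_factor :: "nat \<Rightarrow> bool \<times> step \<Rightarrow> free" where
  "mark_factor N (b, c) = (if b then sc (gamma_par N) * ge N else 1) * gstep c"

definition marked_elt :: "nat \<Rightarrow> (bool \<times> step) list \<Rightarrow> free" where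
  "marked_elt N M = prod_list (map (mark_factor N) M) * ge N"

lemma D_curve_eq: "D_curve N m n C = cls N (marked_elt N (marked_path m n C))"
  by (simp add: D_curve_def marked_elt_def marked_path_def Let_def comp_def)

lemma mark_factor_in:
  assumes "1 \<le> N"
  shows "mark_factor N M \<in> carrier (free_alg N)"
proof -
  obtain b c where "M = (b, c)" by (cases M)
  then show ?thesis
    using assms by (cases c) (auto intro!: free_closed ge_in simp: letters_of_def)
qed

lemma marked_elt_in: "1 \<le> N \<Longrightarrow> marked_elt N M \<in> carrier (free_alg N)"
  unfolding marked_elt_def by (intro mult_in prod_list_in ge_in) (auto intro: mark_factor_in)

text \<open>The identity is stated for arbitrary paths before and after the corner, without
  reference to curves, so that only \<open>N\<close> is left as a parameter.\<close>

definition satisfies_skein :: "nat \<Rightarrow> bool" where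
  "satisfies_skein N \<longleftrightarrow> (\<forall>A B b. cls N (marked_elt N (A @ [(b, Up), (False, Rt)] @ B)) =
     cls N (sc (q_par * t_par) * marked_elt N (A @ [(b, Rt), (False, Up)] @ B) +
       marked_elt N (A @ [(b, Up), (True, Rt)] @ B)))"

text \<open>To compute in the quotient ring with type classes, its carrier is made a type. A type cannot
  depend on \<open>N\<close>, so \<open>N\<close> is fixed once and for all as a potential counterexample.\<close>

definition test_rank :: nat where
  "test_rank = (SOME N. 1 \<le> N \<and> ((\<exists>M\<ge>1. \<not> satisfies_skein M) \<longrightarrow> \<not> satisfies_skein N))"

text \<open>If the identity failed for some rank, the choice would make it fail for
  \<open>test_rank\<close>; a proof there is therefore a proof for all ranks.\<close>

lemma test_rank: "1 \<le> test_rank" "1 \<le> N \<Longrightarrow> satisfies_skein test_rank \<Longrightarrow> satisfies_skein N"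
proof -
  have "1 \<le> test_rank \<and> ((\<exists>M\<ge>1. \<not> satisfies_skein M) \<longrightarrow> \<not> satisfies_skein test_rank)"
    unfolding test_rank_def by (rule someI_ex) auto
  then show "1 \<le> test_rank" "1 \<le> N \<Longrightarrow> satisfies_skein test_rank \<Longrightarrow> satisfies_skein N"
    by blast+
qed

section \<open>The quotient ring as a type\<close>

typedef daha_elt = "carrier (DAHA test_rank)"
  unfolding carrier_DAHA using zero_in by blast

definition proj :: "free \<Rightarrow> daha_elt" where
  "proj a = Abs_daha_elt (cls test_rank a)"

lemma proj_surj: obtains a where "a \<in> carrier (free_alg test_rank)" "x = proj a"
  by (metis Rep_daha_elt Rep_daha_elt_inverse carrier_DAHA imageE proj_def)

lemma Rep_proj: "a \<in> carrier (free_alg test_rank) \<Longrightarrow> Rep_daha_elt (proj a) = cls test_rank a"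
  by (simp add: proj_def Abs_daha_elt_inverse carrier_DAHA)

instantiation daha_elt :: "{ring, monoid_mult}"
begin

definition "0 = proj 0"
definition "1 = proj 1"
definition "x + y = Abs_daha_elt (Rep_daha_elt x \<oplus>\<^bsub>DAHA test_rank\<^esub> Rep_daha_elt y)"
definition "x * y = Abs_daha_elt (Rep_daha_elt x \<otimes>\<^bsub>DAHA test_rank\<^esub> Rep_daha_elt y)"
text \<open>Negation is not a field of the record; multiplication by the class of -1 realises
  it.\<close>

definition "- x = proj (sc (- 1)) * (x :: daha_elt)"
definition "x - y = x + - (y :: daha_elt)"

lemma proj_add_in:
  "a \<in> carrier (free_alg test_rank) \<Longrightarrow> b \<in> carrier (free_alg test_rank) \<Longrightarrow> proj a + proj b = proj (a + b)"
  by (simp add: plus_daha_elt_def Rep_proj cls_ops[OF test_rank(1)]) (simp add: proj_def)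

lemma proj_mult_in:
  "a \<in> carrier (free_alg test_rank) \<Longrightarrow> b \<in> carrier (free_alg test_rank) \<Longrightarrow> proj a * proj b = proj (a * b)"
  by (simp add: times_daha_elt_def Rep_proj cls_ops[OF test_rank(1)]) (simp add: proj_def)

lemma proj_uminus_in: "a \<in> carrier (free_alg test_rank) \<Longrightarrow> - proj a = proj (- a)"
proof -
  have "sc (- 1) = - 1"
    by (simp add: sc_def single_uminus)
  then show "a \<in> carrier (free_alg test_rank) \<Longrightarrow> - proj a = proj (- a)"
    using proj_mult_in[OF sc_in, of a "- 1"] by (simp add: uminus_daha_elt_def)
qed

instance
proof
  fix x y z :: daha_elt
  obtain a b c where abc: "a \<in> carrier (free_alg test_rank)" "b \<in> carrier (free_alg test_rank)"
    "c \<in> carrier (free_alg test_rank)" "x = proj a" "y = proj b" "z = proj c"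
    by (metis proj_surj)
  note [simp] = abc proj_add_in proj_mult_in proj_uminus_in free_closed
    zero_daha_elt_def one_daha_elt_def minus_daha_elt_def
  show "x + y + z = x + (y + z)" by (simp add: add.assoc)
  show "x + y = y + x" by (simp add: add.commute)
  show "0 + x = x" by simp
  show "- x + x = 0" by simp
  show "x - y = x + - y" by simp
  show "x * y * z = x * (y * z)" by (simp add: mult.assoc)
  show "(x + y) * z = x * z + y * z" by (simp add: distrib_right)
  show "x * (y + z) = x * y + x * z" by (simp add: distrib_left)
  show "1 * x = x" by simp
  show "x * 1 = x" by simp
qed

end

abbreviation F :: "free set" where
  "F \<equiv> carrier (free_alg test_rank)"

lemma proj_add: "a \<in> F \<Longrightarrow> b \<in> F \<Longrightarrow> proj (a + b) = proj a + proj b"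
  by (simp add: proj_add_in)

lemma proj_mult: "a \<in> F \<Longrightarrow> b \<in> F \<Longrightarrow> proj (a * b) = proj a * proj b"
  by (simp add: proj_mult_in)

lemma proj_zero: "proj 0 = 0" and proj_one: "proj 1 = 1"
  by (simp_all add: zero_daha_elt_def one_daha_elt_def)

lemma proj_diff: "a \<in> F \<Longrightarrow> b \<in> F \<Longrightarrow> proj (a - b) = proj a - proj b"
  using proj_add[of "a - b" b] by (simp add: diff_in)

lemma proj_sum: "(\<And>x. x \<in> A \<Longrightarrow> f x \<in> F) \<Longrightarrow> proj (sum f A) = (\<Sum>x\<in>A. proj (f x))"
  by (induction A rule: infinite_finite_induct) (simp_all add: proj_zero proj_add free_alg_sum_in)

lemma proj_prod_list: "set as \<subseteq> F \<Longrightarrow> proj (prod_list as) = prod_list (map proj as)"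
  by (induction as) (simp_all add: proj_one proj_mult prod_list_in)

lemma proj_power: "a \<in> F \<Longrightarrow> proj (a ^ k) = proj a ^ k"
  by (induction k) (simp_all add: proj_one proj_mult power_in)

lemma proj_eq_iff: "a \<in> F \<Longrightarrow> b \<in> F \<Longrightarrow> proj a = proj b \<longleftrightarrow> cls test_rank a = cls test_rank b"
  by (simp add: proj_def Abs_daha_elt_inject carrier_DAHA)

lemma proj_rel: "daha_rel test_rank a b \<Longrightarrow> proj a = proj b"
  using cls_rel[of test_rank a b] test_rank by (simp add: proj_def)

lemmas proj_simps = proj_add proj_diff proj_mult proj_one proj_zero

text \<open>Scalars are supported on the empty word and commute with every single word; induction on
  the support extends this to sums.\<close>

lemma proj_sc_central: "proj (sc c) * x = x * proj (sc c)"
proof -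
  obtain a where a: "a \<in> F" "x = proj a"
    by (rule proj_surj)
  have "sc c * a = a * sc c"
  proof (induction a rule: update_induct)
    case (update f w d)
    have "Poly_Mapping.update w d f = Poly_Mapping.single w d + f"
      using update(1)
      by (intro poly_mapping_eqI) (auto simp: lookup_update lookup_add lookup_single in_keys_iff)
    moreover have "sc c * Poly_Mapping.single w d = Poly_Mapping.single w d * sc c"
      by (simp add: sc_def mult_single mult.commute)
    ultimately show ?case
      using update by (simp add: distrib_left distrib_right)
  qed simp
  then show ?thesis
    using a by (simp add: sc_in flip: proj_mult)
qed

lemma sc_hom: "sc (a + b) = sc a + sc b" "sc (a * b) = sc a * sc b" "sc 1 = 1"
  by (simp_all add: sc_def single_add mult_single)

lemma gens_in:
  "i \<in> {1..test_rank} \<Longrightarrow> gX i \<in> F" "i \<in> {1..test_rank} \<Longrightarrow> gXi i \<in> F"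
  "i \<in> {1..test_rank} \<Longrightarrow> gY i \<in> F" "i \<in> {1..test_rank} \<Longrightarrow> gYi i \<in> F" "i \<in> {1..<test_rank} \<Longrightarrow> gT i \<in> F"
  by (auto intro!: gen_in simp: letters_of_def)

interpretation H: hecke_algebra "\<lambda>c. proj (sc c)" "\<lambda>i. proj (gT i)" test_rank t_half
proof
  show "proj (sc c) * x = x * proj (sc c)" for c x
    by (rule proj_sc_central)
  show "t_half \<noteq> 0"
    by (rule t_half_nonzero)
  fix i assume i: "1 \<le> i" "i < test_rank"
  show "(proj (gT i) + proj (sc t_half)) * (proj (gT i) - proj (sc (inverse t_half))) = 0"
    using proj_rel[OF daha_rel.quadratic[of i]] i
    by (simp add: proj_simps free_closed gens_in del: One_nat_def)
next
  fix i assume i: "1 \<le> i" "Suc i < test_rank"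
  show "proj (gT i) * (proj (gT (Suc i)) * proj (gT i)) =
      proj (gT (Suc i)) * (proj (gT i) * proj (gT (Suc i)))"
    using proj_rel[OF daha_rel.braid[of i]] i
    by (simp add: proj_simps free_closed gens_in mult.assoc)
next
  fix i j assume "1 \<le> i" "Suc i < j" "j < test_rank"
  then show "proj (gT i) * proj (gT j) = proj (gT j) * proj (gT i)"
    using proj_rel[OF daha_rel.T_comm[of i test_rank j]] by (simp add: proj_simps gens_in)
qed (simp_all add: sc_hom proj_simps sc_in)

lemma Ti_eq: "i \<in> {1..<test_rank} \<Longrightarrow> H.Ti i = proj (gTi i)"
  by (simp add: H.Ti_def gTi_def proj_add gens_in sc_in)

lemma symmetrizer_eq: "H.symmetrizer = proj (ge test_rank)"
proof -
  have Tw: "H.Tw w = proj (gTw test_rank w)" if "w permutes {1..test_rank}" for w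
    unfolding H.Tw_def gTw_def using some_reduced_word[OF that]
    by (subst proj_prod_list) (auto simp: reduced_word_def intro!: gens_in simp: comp_def)
  have in_F: "sc c * gTw test_rank w \<in> F" if "w permutes {1..test_rank}" for w c
    using that by (intro mult_in sc_in gTw_in)
  have "proj (\<Sum>w | w permutes {1..test_rank}. sc (inverse t_half ^ perm_length test_rank w) * gTw test_rank w) =
      (\<Sum>w | w permutes {1..test_rank}. proj (sc (inverse t_half ^ perm_length test_rank w)) * H.Tw w)"
    by (subst proj_sum) (auto simp: in_F Tw proj_mult sc_in gTw_in simp del: One_nat_def intro!: sum.cong)
  then show ?thesis
    unfolding H.symmetrizer_def ge_def t_par_def
    by (subst proj_mult) (auto intro!: sc_in free_alg_sum_in in_F simp del: One_nat_def)
qed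

interpretation H: daha "\<lambda>c. proj (sc c)" "\<lambda>i. proj (gT i)" test_rank t_half q_par
  "\<lambda>i. proj (gX i)" "\<lambda>i. proj (gXi i)" "\<lambda>i. proj (gY i)" "\<lambda>i. proj (gYi i)"
proof
  show "1 \<le> test_rank" by (rule test_rank)
  fix i
  show "proj (gX i) * proj (gXi i) = 1" "proj (gXi i) * proj (gX i) = 1"
    "proj (gY i) * proj (gYi i) = 1" "proj (gYi i) * proj (gY i) = 1" if "i \<in> {1..test_rank}"
    using proj_rel[OF daha_rel.X_inv_right[OF that]] proj_rel[OF daha_rel.X_inv_left[OF that]]
      proj_rel[OF daha_rel.Y_inv_right[OF that]] proj_rel[OF daha_rel.Y_inv_left[OF that]]
      gens_in(1-4)[OF that]
    by (simp_all add: proj_simps)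
  show "proj (gX i) * proj (gX k) = proj (gX k) * proj (gX i)"
    if "i \<in> {1..test_rank}" "k \<in> {1..test_rank}" for k
    using proj_rel[OF daha_rel.X_comm[OF that]] gens_in(1) that by (simp add: proj_simps)
  show "proj (gT i) * proj (gX i) * proj (gT i) = proj (gX (i + 1))" if "i \<in> {1..<test_rank}"
    using proj_rel[OF daha_rel.TXT[OF that]] that by (simp add: proj_simps gens_in free_closed)
  show "H.Ti i * proj (gY i) * H.Ti i = proj (gY (i + 1))" if "i \<in> {1..<test_rank}"
    using proj_rel[OF daha_rel.TYT[OF that]] that gTi_in[OF that] gens_in(3)[of i]
    by (simp add: Ti_eq proj_simps free_closed)
  show "proj (gT i) * proj (gX k) = proj (gX k) * proj (gT i)"
    if "i \<in> {1..<test_rank}" "k \<in> {1..test_rank}" "\<bar>int i - int k\<bar> > 1" for k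
    using proj_rel[OF daha_rel.TX_comm[OF that]] gens_in(1)[OF that(2)] gens_in(5)[OF that(1)]
    by (simp add: proj_simps)
  show "proj (gT i) * proj (gY k) = proj (gY k) * proj (gT i)"
    if "i \<in> {1..<test_rank}" "k \<in> {1..test_rank}" "\<bar>int i - int k\<bar> > 1" for k
    using proj_rel[OF daha_rel.TY_comm[OF that]] gens_in(3)[OF that(2)] gens_in(5)[OF that(1)]
    by (simp add: proj_simps)
next
  have "set (map gX [1..<test_rank + 1]) \<subseteq> F"
    by (auto intro!: gens_in)
  note P = prod_list_in[OF this] proj_prod_list[OF this]
  have "gY 1 \<in> F"
    by (rule gens_in) (use test_rank in simp)
  then show "proj (gY 1) * prod_list (map (\<lambda>i. proj (gX i)) [1..<test_rank + 1]) =
      proj (sc q_par) * prod_list (map (\<lambda>i. proj (gX i)) [1..<test_rank + 1]) * proj (gY 1)"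
    using proj_rel[OF daha_rel.Y1_X] P
    by (simp add: proj_mult mult_in sc_in comp_def del: upt_Suc One_nat_def)
next
  assume N: "2 \<le> test_rank"
  then have "gXi 1 \<in> F" "gY 2 \<in> F" "gTi 1 \<in> F"
    by (auto intro!: gens_in gTi_in)
  then show "proj (gXi 1) * proj (gY 2) = proj (gY 2) * proj (gXi 1) * H.Ti 1 ^ 2"
    using proj_rel[OF daha_rel.X1i_Y2[OF N]] N
    by (simp add: Ti_eq proj_mult proj_power free_closed del: One_nat_def)
qed

section \<open>The skein identity for marked paths\<close>

abbreviation mark :: "bool \<Rightarrow> daha_elt" where
  "mark b \<equiv> (if b then proj (sc (gamma_par test_rank)) * proj (ge test_rank) else 1)"

lemma gens_1_in: "gX 1 \<in> F" "gY 1 \<in> F" "gYi 1 \<in> F"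
  by (rule gens_in; use test_rank in simp)+

lemma proj_mark_factor:
  "proj (mark_factor test_rank (b, c)) = mark b * proj (gstep c)"
  "proj (gstep Up) = proj (gY 1)"
  "proj (gstep Rt) = proj (gY 1) * (proj (gX 1) * proj (gYi 1))"
proof -
  have step: "gstep c \<in> F"
    using gens_1_in by (cases c) (simp_all add: mult_in del: One_nat_def)
  show "proj (mark_factor test_rank (b, c)) = mark b * proj (gstep c)"
    using step by (cases b) (simp_all add: proj_mult mult_in sc_in ge_in)
  show "proj (gstep Up) = proj (gY 1)"
    "proj (gstep Rt) = proj (gY 1) * (proj (gX 1) * proj (gYi 1))"
    using gens_1_in by (simp_all add: proj_mult mult_in mult.assoc del: One_nat_def)
qed

lemma proj_marked_elt:
  "proj (marked_elt test_rank M) = prod_list (map (\<lambda>x. proj (mark_factor test_rank x)) M) * proj (ge test_rank)"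
proof -
  have "set (map (mark_factor test_rank) M) \<subseteq> F"
    using mark_factor_in[OF test_rank(1)] by auto
  from prod_list_in[OF this] proj_prod_list[OF this] show ?thesis
    by (simp add: marked_elt_def proj_mult ge_in comp_def)
qed

text \<open>The element ends in the symmetrizer, and the factors of each step preserve partial
  symmetry. At a marked vertex the symmetrizer in front provides it anew.\<close>

lemma partially_symmetric_marked_elt: "H.partially_symmetric (proj (marked_elt test_rank M))"
proof (induction M)
  case Nil
  show ?case
    using H.partially_symmetric_symmetrizer[of 1] by (simp add: proj_marked_elt symmetrizer_eq)
next
  case (Cons x M)
  obtain b c where x: "x = (b, c)" by (cases x)
  have eq: "proj (marked_elt test_rank (x # M)) = mark b * (proj (gstep c) * proj (marked_elt test_rank M))"
    unfolding x proj_marked_elt by (simp only: list.map prod_list.Cons proj_mark_factor mult.assoc)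
  have step: "H.partially_symmetric (proj (gstep c) * proj (marked_elt test_rank M))"
  proof (cases c)
    case Up
    then show ?thesis
      using H.partially_symmetric_Y1[OF Cons.IH] by (simp only: proj_mark_factor)
  next
    case Rt
    then show ?thesis
      using H.partially_symmetric_Y1[OF H.partially_symmetric_X1[OF H.partially_symmetric_Yi1[OF Cons.IH]]]
      by (simp only: proj_mark_factor mult.assoc)
  qed
  show ?case
  proof (cases b)
    case True
    have "H.partially_symmetric (proj (sc (gamma_par test_rank)) *
        (H.symmetrizer * (proj (gstep c) * proj (marked_elt test_rank M))))"
      by (rule H.partially_symmetric_mult[OF H.partially_symmetric_symmetrizer])
        (rule proj_sc_central[symmetric])
    then show ?thesis
      unfolding eq using True by (simp add: symmetrizer_eq mult.assoc)
  next
    case False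
    then show ?thesis
      unfolding eq using step by simp
  qed
qed

lemma satisfies_skein_test_rank: "satisfies_skein test_rank"
  unfolding satisfies_skein_def
proof (intro allI)
  fix A B b
  let ?W = "\<lambda>M. marked_elt test_rank (A @ M @ B)"
  \<comment> \<open>\<open>L\<close> collects the factors before the corner, including the mark at
    its start; \<open>R\<close> is everything after it.\<close>
  define L where "L = prod_list (map (\<lambda>x. proj (mark_factor test_rank x)) A) * mark b"
  define R where "R = proj (marked_elt test_rank B)"
  define X Y Yi where "X = proj (gX 1)" and "Y = proj (gY 1)" and "Yi = proj (gYi 1)"
  have Yi_Y: "Yi * (Y * z) = z" for z
    using mult_eq_extend[OF H.Y_inverse(2)[of 1]] test_rank by (simp add: Yi_def Y_def)
  have W: "proj (?W [(b, c), (b', c')]) = L * (proj (gstep c) * (mark b' * (proj (gstep c') * R)))"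
    for c b' c'
    unfolding L_def R_def proj_marked_elt
    by (simp only: map_append list.map prod_list.append prod_list.Cons prod_list.Nil
        proj_mark_factor(1) mult.assoc append_Cons append_Nil)
  have skein: "Y * (X * (Yi * R)) = proj (sc (q_par * t_par)) * (X * R) +
      mark True * (Y * (X * (Yi * R)))"
    unfolding X_def Y_def Yi_def R_def
    using H.skein_relation[OF _ partially_symmetric_marked_elt[of B]] poincare_nonzero[of test_rank]
    by (simp add: symmetrizer_eq gamma_par_def t_par_def mult.assoc)
  have "proj (?W [(b, Up), (False, Rt)]) = L * (Y * (Y * (X * (Yi * R))))"
    unfolding W proj_mark_factor X_def Y_def Yi_def by (simp add: mult.assoc)
  \<comment> \<open>The skein relation is applied to the right step of the corner; its last term is
    that step with a mark at the vertex between.\<close>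
  also have "\<dots> = L * (Y * (proj (sc (q_par * t_par)) * (X * R))) + L * (Y * (mark True * (Y * (X * (Yi * R)))))"
    by (subst skein) (simp only: distrib_left)
  \<comment> \<open>Writing \<open>R\<close> as \<open>Yi * (Y * R)\<close> exhibits a right step
    followed by an up step.\<close>
  also have "L * (Y * (proj (sc (q_par * t_par)) * (X * R))) =
      proj (sc (q_par * t_par)) * (L * (Y * (X * (Yi * (Y * R)))))"
    by (simp only: Yi_Y H.emb_left[of Y] H.emb_left[of L])
  also have "L * (Y * (X * (Yi * (Y * R)))) = proj (?W [(b, Rt), (False, Up)])"
    unfolding W proj_mark_factor X_def Y_def Yi_def by (simp add: mult.assoc)
  also have "L * (Y * (mark True * (Y * (X * (Yi * R))))) = proj (?W [(b, Up), (True, Rt)])"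
    unfolding W proj_mark_factor X_def Y_def Yi_def by (simp only: mult.assoc)
  finally have "proj (?W [(b, Up), (False, Rt)]) =
      proj (sc (q_par * t_par) * ?W [(b, Rt), (False, Up)] + ?W [(b, Up), (True, Rt)])"
    using test_rank by (simp only: proj_add proj_mult mult_in sc_in marked_elt_in)
  then show "cls test_rank (?W [(b, Up), (False, Rt)]) =
      cls test_rank (sc (q_par * t_par) * ?W [(b, Rt), (False, Up)] + ?W [(b, Up), (True, Rt)])"
    using test_rank by (simp only: proj_eq_iff add_in mult_in sc_in marked_elt_in)
qed

text \<open>The spherical algebra and its positive part inherit these operations, so both identities
  may be computed in \<open>DAHA N\<close>.\<close>

lemma SDAHA_ops:
  "add (SDAHA N) = add (DAHA N)" "smult (SDAHA N) = smult (DAHA N)"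
  "add (SDAHA_plus N) = add (DAHA N)" "smult (SDAHA_plus N) = smult (DAHA N)"
  by (simp_all add: SDAHA_plus_def SDAHA_def)

theorem theorem1p7:
  fixes m n :: nat and p :: "int \<times> int" and C_plus C_minus C_zero :: "(real \<times> real) set"
    and r :: real
  assumes "m \<ge> 1" and "n \<ge> 1"
    and "monotone_curve m n C_plus"
    and "monotone_curve m n C_minus"
    and "monotone_curve m n C_zero"
    and "passes_above C_plus (lattice_pt p)"
    and "passes_below C_minus (lattice_pt p)"
    and "lattice_pt p \<in> C_zero"
    and "0 < r" and "r \<le> 1"
    and "C_plus - ball (lattice_pt p) r = C_zero - ball (lattice_pt p) r"
    and "C_minus - ball (lattice_pt p) r = C_zero - ball (lattice_pt p) r"
  shows "(\<forall>N\<ge>1. D_curve N m n C_plus =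
            (q_par * t_par) \<odot>\<^bsub>SDAHA N\<^esub> D_curve N m n C_minus \<oplus>\<^bsub>SDAHA N\<^esub> D_curve N m n C_zero) \<and>
         D_inf m n C_plus =
            (q_par * t_par) \<odot>\<^bsub>SDAHA_inf\<^esub> D_inf m n C_minus \<oplus>\<^bsub>SDAHA_inf\<^esub> D_inf m n C_zero"
proof -
  obtain A B b where M: "marked_path m n C_plus = A @ [(b, Up), (False, Rt)] @ B"
    "marked_path m n C_minus = A @ [(b, Rt), (False, Up)] @ B"
    "marked_path m n C_zero = A @ [(b, Up), (True, Rt)] @ B"
    using marked_paths_of_curves_at_lattice_point[OF assms(1,3-8,10-12)] by blast
  have skein: "D_curve N m n C_plus =
      (q_par * t_par) \<odot>\<^bsub>DAHA N\<^esub> D_curve N m n C_minus \<oplus>\<^bsub>DAHA N\<^esub> D_curve N m n C_zero"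
    if N: "1 \<le> N" for N
    using test_rank(2)[OF N satisfies_skein_test_rank] N
    by (simp only: D_curve_eq M cls_ops cls_smult marked_elt_in mult_in sc_in satisfies_skein_def)
  \<comment> \<open>Operations in the limit are componentwise, so the second claim is the first for
    all \<open>N\<close> at once.\<close>
  then show ?thesis
    by (auto simp: SDAHA_ops SDAHA_inf_def D_inf_def fun_eq_iff)
qed

end
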